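(* Let $d\geq 1$, let $\rho_0,\rho_T\in L^1(\mathbb{R}^d)$ be two probability densities, let $T>0$ and $\epsilon>0$. Then there exist piecewise constant controls $w,a\in BV((0,T);\mathbb{R}^d)$ and $b\in BV((0,T);\mathbb{R})$ such that the solution $\rho$ of \[ \begin{cases} \partial_t\rho+\mathrm{div}_x\big(w(t)\,\sigma(\langle a(t),x\rangle +b(t))\,\rho\big)=0, & (x,t)\in\mathbb{R}^d\times (0,T),\\ \rho(0)=\rho_0, \end{cases} \] satisfies $\|\rho(T)-\rho_T\|_{L^1(\mathbb{R}^d)}\leq \epsilon$.
   Context: $\sigma(z)=\max(z,0)$ is the ReLU function and $\langle\cdot,\cdot\rangle$ the Euclidean inner product. "Piecewise constant" means constant on each of finitely many subintervals of $(0,T)$. For bounded measurable controls the velocity field $V(x,t)=w(t)\sigma(\langle a(t),x\rangle+b(t))$ is globally Lipschitz in $x$, so the continuity equation is well-posed (solutions understood in the distributional sense, given by transport along the characteristics $x'=V(x,t)$). *)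

theory Defs
  imports "HOL-Analysis.Analysis"
begin

definition relu :: "real \<Rightarrow> real" where
  "relu z = max z 0"

definition piecewise_constant :: "real \<Rightarrow> (real \<Rightarrow> 'b) \<Rightarrow> bool" where
  "piecewise_constant T f \<longleftrightarrow>
     (\<exists>S. finite S \<and> (\<forall>t1 t2. 0 < t1 \<and> t1 \<le> t2 \<and> t2 < T \<and> {t1..t2} \<inter> S = {} \<longrightarrow> f t1 = f t2))"

definition relu_field :: "(real \<Rightarrow> 'a::euclidean_space) \<Rightarrow> (real \<Rightarrow> 'a) \<Rightarrow> (real \<Rightarrow> real)
    \<Rightarrow> 'a \<Rightarrow> real \<Rightarrow> 'a" where
  "relu_field w a b x t = relu (inner (a t) x + b t) *\<^sub>R w t"

text \<open>Phi is the flow of the characteristics x' = V(x,t) on [0,T], starting at time 0: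
  for each x, t \<mapsto> Phi t x is continuous on [0,T], equals x at t = 0 and solves the ODE at
  all times of (0,T) except finitely many (the switching times of the controls).\<close>
definition is_flow :: "real \<Rightarrow> ('a::euclidean_space \<Rightarrow> real \<Rightarrow> 'a) \<Rightarrow> (real \<Rightarrow> 'a \<Rightarrow> 'a) \<Rightarrow> bool" where
  "is_flow T V Phi \<longleftrightarrow>
     (\<forall>x. Phi 0 x = x \<and> continuous_on {0..T} (\<lambda>t. Phi t x)) \<and>
     (\<exists>S. finite S \<and> (\<forall>x. \<forall>t \<in> {0<..<T} - S.
        ((\<lambda>s. Phi s x) has_vector_derivative V (Phi t x) t) (at t)))"

definition prob_density :: "('a::euclidean_space \<Rightarrow> real) \<Rightarrow> bool" where
  "prob_density f \<longleftrightarrow> integrable lborel f \<and> (AE x in lborel. 0 \<le> f x) \<and> (\<integral>x. f x \<partial>lborel) = 1"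

text \<open>rho1 is (a representative of) the solution at time T of the continuity equation with
  initial datum rho0 transported by the flow Phi: the pushforward of rho0 dx under Phi T.\<close>
definition transported_density ::
    "real \<Rightarrow> (real \<Rightarrow> 'a::euclidean_space \<Rightarrow> 'a) \<Rightarrow> ('a \<Rightarrow> real) \<Rightarrow> ('a \<Rightarrow> real) \<Rightarrow> bool" where
  "transported_density T Phi rho0 rho1 \<longleftrightarrow>
     Phi T \<in> borel_measurable lborel \<and> integrable lborel rho1 \<and> (AE x in lborel. 0 \<le> rho1 x) \<and>
     distr (density lborel (\<lambda>x. ennreal (rho0 x))) lborel (Phi T) = density lborel (\<lambda>x. ennreal (rho1 x))"

end

theory Submission
  imports Defs
begin

text \<open>
  With constant controls the flow is an explicit piecewise linear homeomorphism: a ReLU shear, or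
  the stretching of a half-space by a positive factor. By rescaling time, every finite composition
  of such maps is the flow at time \<open>T\<close> for piecewise constant controls, and these compositions form
  a group. Pushforward is an isometry for the total variation distance, so being approximately
  transportable into each other is an equivalence relation on densities, closed in \<open>L\<^sup>1\<close>. It
  therefore suffices to bring every density that is constant on the cells of a cubic grid to the
  uniform density on the unit cube.

  A jump shear, translating a half-space parallel to its boundary, is a limit of differences of two
  ReLU shears, because these differ from it only on a thin strip. Sums of jump shears displace each
  grid layer separately. First each cell is displaced in one fixed direction by an amount depending
  on its other coordinates, so that all cells get different coordinates in that direction; then
  displacements depending on this coordinate only put all cells in one row. There stretchings
  equalise the densities of adjacent slabs one after the other, which leaves the uniform
  density on a box, and further stretchings turn it into the unit cube.
\<close>

section \<open>ReLU maps and their realization as flows\<close>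

text \<open>For basis vectors \<open>i\<close> and \<open>j\<close> this is a shear if they differ.
  If they coincide, it stretches the half-space where \<open>x \<bullet> j + b\<close> is positive
  by the factor \<open>1 + c\<close> and fixes the rest.\<close>

definition relu_step :: "real \<Rightarrow> 'a::euclidean_space \<Rightarrow> 'a \<Rightarrow> real \<Rightarrow> 'a \<Rightarrow> 'a" where
  "relu_step c i j b x = x + (c * relu (x \<bullet> j + b)) *\<^sub>R i"

text \<open>In the stretching case \<open>c > -1\<close> makes the factor \<open>1 + c\<close>
  positive; this is exactly what invertibility and realization by a flow require.\<close>

inductive relu_map :: "('a::euclidean_space \<Rightarrow> 'a) \<Rightarrow> bool" where
  relu_map_id: "relu_map (\<lambda>x. x)"
| relu_map_step: "\<lbrakk>i \<in> Basis; j \<in> Basis; i \<noteq> j \<or> c > -1\<rbrakk> \<Longrightarrow> relu_map (relu_step c i j b)"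
| relu_map_comp: "\<lbrakk>relu_map F; relu_map G\<rbrakk> \<Longrightarrow> relu_map (\<lambda>x. G (F x))"

text \<open>A shear does not change \<open>x \<bullet> j\<close>, so \<open>-c\<close> undoes it. A
  stretching by a positive factor preserves its half-space and is undone there by the reciprocal
  factor.\<close>

lemma relu_step_inverse:
  fixes i j :: "'a::euclidean_space"
  assumes "i \<in> Basis" "j \<in> Basis" "i \<noteq> j \<or> c > -1"
  shows "\<exists>c'. (i \<noteq> j \<or> c' > -1) \<and> (\<forall>x. relu_step c' i j b (relu_step c i j b x) = x)
              \<and> (\<forall>x. relu_step c i j b (relu_step c' i j b x) = x)"
proof (cases "i = j")
  case False
  then have "i \<bullet> j = 0" using assms by (simp add: inner_Basis)
  then show ?thesis using False
    by (intro exI[of _ "-c"]) (simp add: relu_step_def inner_add_left inner_diff_left)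
next
  case True
  then have c: "c > -1" using assms by auto
  have jj: "j \<bullet> j = 1" using assms by (simp add: inner_Basis)
  define c' where "c' = 1 / (1 + c) - 1"
  have c': "c' > -1" using c by (simp add: c'_def)
  \<comment> \<open>The claim is symmetric enough in \<open>r\<close> and \<open>s\<close> to serve
    for both orders of composition; \<open>s > -1\<close> keeps a point with \<open>z > 0\<close>
    inside the half-space after the first map.\<close>
  have inv: "relu_step r j j b (relu_step s j j b x) = x"
    if "(1 + r) * (1 + s) = 1" "s > -1" for r s and x :: 'a
  proof -
    define z where "z = x \<bullet> j + b"
    show ?thesis
    proof (cases "z > 0")
      case True
      have "(1 + s) * z > 0" using True that by simp
      then have "relu (x \<bullet> j + s * z + b) = (1 + s) * z"
        by (simp add: relu_def z_def algebra_simps)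
      moreover have "relu (x \<bullet> j + b) = z" using True by (simp add: relu_def z_def)
      moreover have "s * z + r * ((1 + s) * z) = 0"
      proof -
        have "s * z + r * ((1 + s) * z) = ((1 + r) * (1 + s) - 1) * z" by (simp add: algebra_simps)
        then show ?thesis using that by simp
      qed
      ultimately show ?thesis
        by (simp add: relu_step_def inner_add_left jj add.assoc flip: scaleR_add_left)
    next
      case False
      then have "relu (x \<bullet> j + b) = 0" by (simp add: relu_def z_def)
      then show ?thesis by (simp add: relu_step_def)
    qed
  qed
  have "(1 + c') * (1 + c) = 1" "(1 + c) * (1 + c') = 1" using c by (auto simp: c'_def)
  then show ?thesis using True c' c inv by blast
qed

lemma relu_map_inverse:
  fixes F :: "'a::euclidean_space \<Rightarrow> 'a"
  assumes "relu_map F"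
  shows "\<exists>H. relu_map H \<and> (\<forall>x. H (F x) = x) \<and> (\<forall>x. F (H x) = x)"
  using assms
proof induction
  case relu_map_id
  then show ?case by (intro exI[of _ "\<lambda>x. x"]) (auto intro: relu_map.intros)
next
  case (relu_map_step i j c b)
  obtain c' where "i \<noteq> j \<or> c' > -1" "\<forall>x. relu_step c' i j b (relu_step c i j b x) = x"
     "\<forall>x. relu_step c i j b (relu_step c' i j b x) = x"
    using relu_step_inverse[OF relu_map_step] by blast
  with relu_map_step show ?case
    by (intro exI[of _ "relu_step c' i j b"]) (auto intro: relu_map.intros)
next
  case (relu_map_comp F G)
  then obtain F' G' where "relu_map F'" "\<forall>x. F' (F x) = x" "\<forall>x. F (F' x) = x"
    "relu_map G'" "\<forall>x. G' (G x) = x" "\<forall>x. G (G' x) = x" by blast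
  then show ?case
    by (intro exI[of _ "\<lambda>x. F' (G' x)"]) (auto intro: relu_map.intros)
qed

section \<open>Measurability, Lipschitz continuity and null sets\<close>

lemma relu_map_measurable [measurable_dest]:
  "relu_map F \<Longrightarrow> F \<in> borel_measurable borel"
proof (induction rule: relu_map.induct)
  case (relu_map_step i j c b)
  show ?case unfolding relu_step_def[abs_def] relu_def by measurable
next
  case (relu_map_comp F G)
  then show ?case by simp
qed simp

lemma relu_map_vimage_borel:
  assumes "relu_map F" "A \<in> sets borel"
  shows "F -` A \<in> sets borel"
  using measurable_sets[OF relu_map_measurable[OF assms(1)] assms(2)] by simp

lemma relu_map_Lipschitz:
  fixes F :: "'a::euclidean_space \<Rightarrow> 'a"
  assumes "relu_map F"
  shows "\<exists>B\<ge>0. \<forall>x y. norm (F x - F y) \<le> B * norm (x - y)"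
  using assms
proof induction
  case relu_map_id
  then show ?case by (intro exI[of _ 1]) auto
next
  case (relu_map_step i j c b)
  have "norm (relu_step c i j b x - relu_step c i j b y) \<le> (1 + \<bar>c\<bar>) * norm (x - y)" for x y
  proof -
    have "relu_step c i j b x - relu_step c i j b y
        = (x - y) + (c * (relu (x \<bullet> j + b) - relu (y \<bullet> j + b))) *\<^sub>R i"
      by (simp add: relu_step_def algebra_simps)
    also have "norm \<dots> \<le> norm (x - y) + \<bar>c * (relu (x \<bullet> j + b) - relu (y \<bullet> j + b))\<bar>"
      using relu_map_step by (intro order.trans[OF norm_triangle_ineq]) simp
    also have "\<dots> = norm (x - y) + \<bar>c\<bar> * \<bar>relu (x \<bullet> j + b) - relu (y \<bullet> j + b)\<bar>"
      by (simp add: abs_mult)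
    finally have 1: "norm (relu_step c i j b x - relu_step c i j b y)
        \<le> norm (x - y) + \<bar>c\<bar> * \<bar>relu (x \<bullet> j + b) - relu (y \<bullet> j + b)\<bar>" .
    have "\<bar>relu (x \<bullet> j + b) - relu (y \<bullet> j + b)\<bar> \<le> norm (x - y)"
    proof -
      have "\<bar>relu (x \<bullet> j + b) - relu (y \<bullet> j + b)\<bar> \<le> \<bar>(x - y) \<bullet> j\<bar>"
        by (simp add: relu_def inner_diff_left)
      then show ?thesis using relu_map_step Basis_le_norm[of j "x - y"] by simp
    qed
    then have "norm (x - y) + \<bar>c\<bar> * \<bar>relu (x \<bullet> j + b) - relu (y \<bullet> j + b)\<bar>
        \<le> norm (x - y) + \<bar>c\<bar> * norm (x - y)"
      by (intro add_left_mono mult_left_mono) auto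
    with 1 show ?thesis by (simp add: algebra_simps)
  qed
  then show ?case by (intro exI[of _ "1 + \<bar>c\<bar>"]) auto
next
  case (relu_map_comp F G)
  then obtain B C where B: "B \<ge> 0" "\<And>x y. norm (F x - F y) \<le> B * norm (x - y)"
    and C: "C \<ge> 0" "\<And>x y. norm (G x - G y) \<le> C * norm (x - y)" by blast
  have "norm (G (F x) - G (F y)) \<le> (C * B) * norm (x - y)" for x y
  proof -
    have "norm (G (F x) - G (F y)) \<le> C * norm (F x - F y)" by (rule C)
    also have "\<dots> \<le> C * (B * norm (x - y))" by (intro mult_left_mono B C)
    finally show ?thesis by simp
  qed
  then show ?case using B C by (intro exI[of _ "C * B"]) auto
qed

text \<open>The preimage is the image under the inverse, which is again a ReLU map and hence
  Lipschitz, and Lipschitz maps preserve negligible sets. This makes pushforwards of densities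
  absolutely continuous.\<close>

lemma relu_map_vimage_null:
  fixes F :: "'a::euclidean_space \<Rightarrow> 'a"
  assumes F: "relu_map F" and N: "N \<in> null_sets lborel"
  shows "F -` N \<in> null_sets lborel"
proof -
  obtain H where H: "relu_map H" "\<And>x. H (F x) = x" "\<And>x. F (H x) = x"
    using relu_map_inverse[OF F] by blast
  obtain B where B: "\<And>x y. norm (H x - H y) \<le> B * norm (x - y)"
    using relu_map_Lipschitz[OF H(1)] by blast
  have "negligible N"
    using N by (simp add: negligible_iff_null_sets null_sets_completionI)
  then have "negligible (H ` N)"
    by (rule negligible_locally_Lipschitz_image[rotated])
      (auto intro!: exI[of _ UNIV] exI[of _ B] B)
  moreover have "H ` N = F -` N"
    using H by (auto simp: image_iff) (metis H(2))
  moreover have "F -` N \<in> sets borel"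
    using N by (intro relu_map_vimage_borel[OF F]) auto
  ultimately show ?thesis
    by (simp add: negligible_iff_null_sets null_sets_completion_iff)
qed

section \<open>Time-\<open>T\<close> maps of piecewise constant controls\<close>

definition realizable :: "real \<Rightarrow> ('a::euclidean_space \<Rightarrow> 'a) \<Rightarrow> bool" where
  "realizable T F \<longleftrightarrow> (\<exists>w a b Phi. piecewise_constant T w \<and> piecewise_constant T a \<and>
     piecewise_constant T b \<and> is_flow T (relu_field w a b) Phi \<and> Phi T = F)"

lemma piecewise_constant_const: "piecewise_constant T (\<lambda>t. c)"
  by (auto simp: piecewise_constant_def)

lemma realizable_constI:
  fixes w a :: "'a::euclidean_space"
  assumes "\<And>x. Phi 0 x = x" "\<And>x. Phi T x = F x"
    and deriv: "\<And>t x. ((\<lambda>s. Phi s x) has_vector_derivative relu (a \<bullet> Phi t x + b) *\<^sub>R w) (at t)"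
  shows "realizable T F"
  unfolding realizable_def
proof (intro exI conjI)
  have "continuous_on {0..T} (\<lambda>t. Phi t x)" for x
    by (rule continuous_at_imp_continuous_on) (use deriv has_vector_derivative_continuous in blast)
  then show "is_flow T (relu_field (\<lambda>_. w) (\<lambda>_. a) (\<lambda>_. b)) Phi"
    unfolding is_flow_def relu_field_def using assms by (auto intro!: exI[of _ "{}"])
qed (use assms in \<open>auto simp: piecewise_constant_const\<close>)

lemma realizable_id: "realizable T (\<lambda>x. x)"
  by (rule realizable_constI[where Phi = "\<lambda>t x. x" and w = 0 and a = 0 and b = 0]) auto

text \<open>Along a shear the argument of the ReLU is constant in time, so the motion is uniform. In
  the stretching case \<open>z = x \<bullet> j + b\<close> obeys a linear equation
  \<open>z' = \<kappa> z\<close> where it is positive, so it grows or decays exponentially.\<close>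

lemma realizable_relu_step:
  fixes i j :: "'a::euclidean_space"
  assumes "i \<in> Basis" "j \<in> Basis" "i \<noteq> j \<or> c > -1" "T > 0"
  shows "realizable T (relu_step c i j b)"
proof (cases "i = j")
  case False
  then have ij: "j \<bullet> i = 0" "i \<bullet> j = 0" using assms by (auto simp: inner_Basis)
  show ?thesis
  proof (rule realizable_constI[where Phi = "\<lambda>t. relu_step (t * (c / T)) i j b"
        and w = "(c / T) *\<^sub>R i" and a = j and b = b])
    show "((\<lambda>s. relu_step (s * (c / T)) i j b x) has_vector_derivative
        relu (j \<bullet> relu_step (t * (c / T)) i j b x + b) *\<^sub>R (c / T) *\<^sub>R i) (at t)" for t x
      unfolding relu_step_def
      using assms(4) by (auto intro!: derivative_eq_intros simp: inner_add_right ij inner_commute)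
  qed (use assms in \<open>auto simp: relu_step_def\<close>)
next
  case True
  then have c: "c > -1" and jj: "j \<bullet> j = 1" using assms by (auto simp: inner_Basis)
  \<comment> \<open>The rate is chosen so that the factor at time \<open>T\<close> is
    \<open>1 + c\<close>; the logarithm exists because \<open>c > -1\<close>.\<close>
  define \<kappa> where "\<kappa> = ln (1 + c) / T"
  have \<kappa>: "exp (T * \<kappa>) = 1 + c" using c assms by (simp add: \<kappa>_def)
  have key: "relu (j \<bullet> relu_step (exp (t * \<kappa>) - 1) j j b x + b) = exp (t * \<kappa>) * relu (x \<bullet> j + b)" for t x
  proof (cases "x \<bullet> j + b > 0")
    case True
    have "j \<bullet> relu_step (exp (t * \<kappa>) - 1) j j b x + b = exp (t * \<kappa>) * (x \<bullet> j + b)"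
      using True by (simp add: relu_step_def inner_add_right jj relu_def inner_commute algebra_simps)
    then show ?thesis using True by (simp add: relu_def)
  next
    case False
    then show ?thesis by (simp add: relu_step_def relu_def inner_commute)
  qed
  show ?thesis
  proof (rule realizable_constI[where Phi = "\<lambda>t. relu_step (exp (t * \<kappa>) - 1) j j b"
        and w = "\<kappa> *\<^sub>R j" and a = j and b = b])
    show "((\<lambda>s. relu_step (exp (s * \<kappa>) - 1) j j b x) has_vector_derivative
        relu (j \<bullet> relu_step (exp (t * \<kappa>) - 1) j j b x + b) *\<^sub>R \<kappa> *\<^sub>R j) (at t)" for t x
      unfolding key unfolding relu_step_def
      by (auto intro!: derivative_eq_intros simp: algebra_simps)
  qed (use True \<kappa> in \<open>auto simp: relu_step_def\<close>)
qed

lemma piecewise_constant_append: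
  assumes "piecewise_constant T1 f" "piecewise_constant T2 g"
  shows "piecewise_constant (T1 + T2) (\<lambda>t. if t \<le> T1 then f t else g (t - T1))"
proof -
  obtain S1 where S1: "finite S1" "\<And>t1 t2. \<lbrakk>0 < t1; t1 \<le> t2; t2 < T1; {t1..t2} \<inter> S1 = {}\<rbrakk> \<Longrightarrow> f t1 = f t2"
    using assms(1) unfolding piecewise_constant_def by blast
  obtain S2 where S2: "finite S2" "\<And>t1 t2. \<lbrakk>0 < t1; t1 \<le> t2; t2 < T2; {t1..t2} \<inter> S2 = {}\<rbrakk> \<Longrightarrow> g t1 = g t2"
    using assms(2) unfolding piecewise_constant_def by blast
  \<comment> \<open>The junction \<open>T1\<close> counts as a switching time, so an interval
    avoiding \<open>S\<close> lies entirely on one side of it.\<close>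
  define S where "S = S1 \<union> {T1} \<union> (\<lambda>t. t + T1) ` S2"
  show ?thesis unfolding piecewise_constant_def
  proof (intro exI[of _ S] conjI allI impI)
    show "finite S" using S1 S2 by (simp add: S_def)
    fix t1 t2 assume t: "0 < t1 \<and> t1 \<le> t2 \<and> t2 < T1 + T2 \<and> {t1..t2} \<inter> S = {}"
    then have "{t1..t2} \<inter> S1 = {}" "T1 \<notin> {t1..t2}" by (auto simp: S_def)
    have "{t1 - T1..t2 - T1} \<inter> S2 = {}"
    proof -
      have "s + T1 \<notin> {t1..t2}" if "s \<in> S2" for s using t that by (auto simp: S_def)
      then show ?thesis by (force simp: algebra_simps)
    qed
    then show "(if t1 \<le> T1 then f t1 else g (t1 - T1)) = (if t2 \<le> T1 then f t2 else g (t2 - T1))"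
      using S1(2)[of t1 t2] S2(2)[of "t1 - T1" "t2 - T1"] t \<open>T1 \<notin> {t1..t2}\<close> \<open>{t1..t2} \<inter> S1 = {}\<close>
      by (auto simp: not_le)
  qed
qed

text \<open>The second flow is started at the endpoint of the first. The trajectories match at
  \<open>T1\<close> because \<open>Phi2 0\<close> is the identity; the ODE may fail there, so
  \<open>T1\<close> joins the exceptional set.\<close>

lemma is_flow_append:
  fixes Phi1 Phi2 :: "real \<Rightarrow> 'a::euclidean_space \<Rightarrow> 'a"
  assumes "is_flow T1 V1 Phi1" "is_flow T2 V2 Phi2" "T1 > 0" "T2 > 0"
  shows "is_flow (T1 + T2) (\<lambda>x t. if t \<le> T1 then V1 x t else V2 x (t - T1))
    (\<lambda>t x. if t \<le> T1 then Phi1 t x else Phi2 (t - T1) (Phi1 T1 x))" (is "is_flow _ ?V ?Phi")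
proof -
  obtain S1 where S1: "finite S1" "\<And>x t. t \<in> {0<..<T1} - S1 \<Longrightarrow>
      ((\<lambda>s. Phi1 s x) has_vector_derivative V1 (Phi1 t x) t) (at t)"
    using assms(1) unfolding is_flow_def by blast
  obtain S2 where S2: "finite S2" "\<And>x t. t \<in> {0<..<T2} - S2 \<Longrightarrow>
      ((\<lambda>s. Phi2 s x) has_vector_derivative V2 (Phi2 t x) t) (at t)"
    using assms(2) unfolding is_flow_def by blast
  have P: "\<And>x. Phi1 0 x = x" "\<And>x. Phi2 0 x = x"
    and c1: "\<And>x. continuous_on {0..T1} (\<lambda>t. Phi1 t x)"
    and c2: "\<And>x. continuous_on {0..T2} (\<lambda>t. Phi2 t x)"
    using assms unfolding is_flow_def by auto
  define S where "S = S1 \<union> {T1} \<union> (\<lambda>t. t + T1) ` S2"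
  show ?thesis unfolding is_flow_def
  proof (intro conjI allI exI[of _ S] ballI)
    show "?Phi 0 x = x" for x using P assms by simp
    show "finite S" using S1 S2 by (simp add: S_def)
    show "continuous_on {0..T1 + T2} (\<lambda>t. ?Phi t x)" for x
    proof -
      have "continuous_on {T1..T1 + T2} (\<lambda>t. Phi2 (t - T1) (Phi1 T1 x))"
        by (rule continuous_on_compose2[OF c2]) (auto intro!: continuous_intros)
      moreover have "{0..T1 + T2} = {0..T1} \<union> {T1..T1 + T2}" using assms by auto
      ultimately show ?thesis using c1[of x]
        by (auto intro!: continuous_on_cases simp: P)
    qed
    fix x t assume t: "t \<in> {0<..<T1 + T2} - S"
    show "((\<lambda>s. ?Phi s x) has_vector_derivative ?V (?Phi t x) t) (at t)"
    proof (cases "t < T1")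
      case True
      then have "((\<lambda>s. Phi1 s x) has_vector_derivative V1 (Phi1 t x) t) (at t)"
        using t by (intro S1) (auto simp: S_def)
      then have "((\<lambda>s. ?Phi s x) has_vector_derivative V1 (Phi1 t x) t) (at t)"
        by (rule has_vector_derivative_transform_within_open[where S = "{..<T1}"]) (use True in auto)
      then show ?thesis using True by simp
    next
      case False
      then have *: "t > T1" using t by (auto simp: S_def)
      have "t - T1 \<notin> S2" using t by (force simp: S_def)
      then have "((\<lambda>s. Phi2 s (Phi1 T1 x)) has_vector_derivative V2 (Phi2 (t - T1) (Phi1 T1 x)) (t - T1)) (at (t - T1))"
        using t * by (intro S2) auto
      moreover have "((\<lambda>s. s - T1) has_vector_derivative 1) (at t)"
        by (auto intro!: derivative_eq_intros)
      ultimately have "((\<lambda>s. Phi2 (s - T1) (Phi1 T1 x)) has_vector_derivative V2 (Phi2 (t - T1) (Phi1 T1 x)) (t - T1)) (at t)"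
        using vector_diff_chain_at[of "\<lambda>s. s - T1" 1 t "\<lambda>s. Phi2 s (Phi1 T1 x)"] by (simp add: o_def)
      then have "((\<lambda>s. ?Phi s x) has_vector_derivative V2 (Phi2 (t - T1) (Phi1 T1 x)) (t - T1)) (at t)"
        by (rule has_vector_derivative_transform_within_open[where S = "{T1<..}"]) (use * in auto)
      then show ?thesis using * by simp
    qed
  qed
qed

lemma realizable_comp:
  assumes "realizable T1 F" "realizable T2 G" "T1 > 0" "T2 > 0"
  shows "realizable (T1 + T2) (\<lambda>x. G (F x))"
proof -
  obtain w1 a1 b1 Phi1 where 1: "piecewise_constant T1 w1" "piecewise_constant T1 a1"
     "piecewise_constant T1 b1" "is_flow T1 (relu_field w1 a1 b1) Phi1" "Phi1 T1 = F"
    using assms(1) unfolding realizable_def by blast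
  obtain w2 a2 b2 Phi2 where 2: "piecewise_constant T2 w2" "piecewise_constant T2 a2"
     "piecewise_constant T2 b2" "is_flow T2 (relu_field w2 a2 b2) Phi2" "Phi2 T2 = G"
    using assms(2) unfolding realizable_def by blast
  show ?thesis unfolding realizable_def
  proof (intro exI conjI)
    show "is_flow (T1 + T2) (relu_field (\<lambda>t. if t \<le> T1 then w1 t else w2 (t - T1))
       (\<lambda>t. if t \<le> T1 then a1 t else a2 (t - T1)) (\<lambda>t. if t \<le> T1 then b1 t else b2 (t - T1)))
       (\<lambda>t x. if t \<le> T1 then Phi1 t x else Phi2 (t - T1) (Phi1 T1 x))"
      using is_flow_append[OF 1(4) 2(4) assms(3,4)]
      by (rule back_subst[where P = "\<lambda>V. is_flow _ V _"]) (auto simp: fun_eq_iff relu_field_def)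
  qed (use 1 2 assms in \<open>auto intro: piecewise_constant_append\<close>)
qed

text \<open>The induction runs over arbitrary \<open>T\<close>, since a composition grants each
  factor half of the available time.\<close>

lemma relu_map_realizable:
  assumes "relu_map F" "T > 0"
  shows "realizable T F"
  using assms
proof (induction arbitrary: T)
  case relu_map_id
  show ?case by (rule realizable_id)
next
  case (relu_map_step i j c b)
  then show ?case by (intro realizable_relu_step)
next
  case (relu_map_comp F G)
  then have "realizable (T / 2 + T / 2) (\<lambda>x. G (F x))"
    by (intro realizable_comp) auto
  then show ?case by simp
qed

section \<open>Approximate reachability\<close>

text \<open>Measures enter only through their set functions, and total variation closeness is setwise
  closeness; the pushforward of \<open>m\<close> under \<open>F\<close> is then \<open>\<lambda>A. m (F -` A)\<close>.\<close>
definition reach :: "('a::euclidean_space set \<Rightarrow> real) \<Rightarrow> ('a set \<Rightarrow> real) \<Rightarrow> bool" where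
  "reach m m' \<longleftrightarrow> (\<forall>\<epsilon>>0. \<exists>F. relu_map F \<and> (\<forall>A\<in>sets borel. \<bar>m (F -` A) - m' A\<bar> \<le> \<epsilon>))"

lemma reach_relu_map: "relu_map F \<Longrightarrow> reach m (\<lambda>A. m (F -` A))"
  unfolding reach_def by (intro allI impI exI[of _ F]) auto

lemma reach_cong:
  assumes "\<And>A. A \<in> sets borel \<Longrightarrow> m A = n A" "\<And>A. A \<in> sets borel \<Longrightarrow> m' A = n' A"
  shows "reach m m' \<longleftrightarrow> reach n n'"
  unfolding reach_def
  by (intro all_cong1 imp_cong ex_cong1 conj_cong ball_cong) (auto simp: assms relu_map_vimage_borel)

lemma reach_eqI: "(\<And>A. A \<in> sets borel \<Longrightarrow> m A = n A) \<Longrightarrow> reach m n"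
  unfolding reach_def by (intro allI impI exI[of _ "\<lambda>x. x"]) (auto intro: relu_map_id)

text \<open>The inverse of an approximating map has the same error: its estimate for
  \<open>A\<close> is the original one for the preimage of \<open>A\<close> under the
  inverse.\<close>

lemma reach_sym:
  fixes m m' :: "'a::euclidean_space set \<Rightarrow> real"
  assumes "reach m m'"
  shows "reach m' m"
  unfolding reach_def
proof (intro allI impI)
  fix \<epsilon> :: real assume "\<epsilon> > 0"
  then obtain F where F: "relu_map F" "\<And>A. A \<in> sets borel \<Longrightarrow> \<bar>m (F -` A) - m' A\<bar> \<le> \<epsilon>"
    using assms unfolding reach_def by blast
  obtain H where H: "relu_map H" "\<And>x. H (F x) = x" "\<And>x. F (H x) = x"
    using relu_map_inverse[OF F(1)] by blast
  have "\<bar>m' (H -` A) - m A\<bar> \<le> \<epsilon>" if "A \<in> sets borel" for A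
  proof -
    have "F -` (H -` A) = A" by (auto simp: H)
    with F(2)[OF relu_map_vimage_borel[OF H(1) that]] show ?thesis by (simp add: abs_minus_commute)
  qed
  with H show "\<exists>F. relu_map F \<and> (\<forall>A\<in>sets borel. \<bar>m' (F -` A) - m A\<bar> \<le> \<epsilon>)" by blast
qed

text \<open>Pulling Borel sets back along a ReLU map does not increase a setwise distance, so the
  errors of the two maps add up.\<close>

lemma reach_trans [trans]:
  fixes m m' m'' :: "'a::euclidean_space set \<Rightarrow> real"
  assumes "reach m m'" "reach m' m''"
  shows "reach m m''"
  unfolding reach_def
proof (intro allI impI)
  fix \<epsilon> :: real assume \<epsilon>: "\<epsilon> > 0"
  obtain F where F: "relu_map F" "\<And>A. A \<in> sets borel \<Longrightarrow> \<bar>m (F -` A) - m' A\<bar> \<le> \<epsilon> / 2"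
    using assms(1) \<epsilon> unfolding reach_def by (meson half_gt_zero)
  obtain H where H: "relu_map H" "\<And>A. A \<in> sets borel \<Longrightarrow> \<bar>m' (H -` A) - m'' A\<bar> \<le> \<epsilon> / 2"
    using assms(2) \<epsilon> unfolding reach_def by (meson half_gt_zero)
  have "\<bar>m ((\<lambda>x. H (F x)) -` A) - m'' A\<bar> \<le> \<epsilon>" if "A \<in> sets borel" for A
  proof -
    have eq: "(\<lambda>x. H (F x)) -` A = F -` (H -` A)" by auto
    show ?thesis
      using F(2)[OF relu_map_vimage_borel[OF H(1) that]] H(2)[OF that] unfolding eq by linarith
  qed
  with F H show "\<exists>F. relu_map F \<and> (\<forall>A\<in>sets borel. \<bar>m (F -` A) - m'' A\<bar> \<le> \<epsilon>)"
    by (intro exI[of _ "\<lambda>x. H (F x)"]) (auto intro: relu_map_comp)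
qed

text \<open>Both ends may be perturbed, again because pushforward does not increase setwise
  distances: the three errors are those at the source, of the map, and at the target.\<close>

lemma reach_closed:
  assumes "\<And>\<epsilon>. \<epsilon> > 0 \<Longrightarrow> \<exists>n n'. reach n n' \<and> (\<forall>A\<in>sets borel. \<bar>m A - n A\<bar> \<le> \<epsilon>)
             \<and> (\<forall>A\<in>sets borel. \<bar>m' A - n' A\<bar> \<le> \<epsilon>)"
  shows "reach m m'"
  unfolding reach_def
proof (intro allI impI)
  fix \<epsilon> :: real assume \<epsilon>: "\<epsilon> > 0"
  then obtain n n' where n: "reach n n'" "\<And>A. A \<in> sets borel \<Longrightarrow> \<bar>m A - n A\<bar> \<le> \<epsilon> / 3"
      "\<And>A. A \<in> sets borel \<Longrightarrow> \<bar>m' A - n' A\<bar> \<le> \<epsilon> / 3"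
    using assms[of "\<epsilon> / 3"] by auto
  obtain F where F: "relu_map F" "\<And>A. A \<in> sets borel \<Longrightarrow> \<bar>n (F -` A) - n' A\<bar> \<le> \<epsilon> / 3"
    using n(1) \<epsilon> unfolding reach_def by (meson divide_pos_pos zero_less_numeral)
  have "\<bar>m (F -` A) - m' A\<bar> \<le> \<epsilon>" if "A \<in> sets borel" for A
    using F(2)[OF that] n(3)[OF that] n(2)[OF relu_map_vimage_borel[OF F(1) that]] by linarith
  with F show "\<exists>F. relu_map F \<and> (\<forall>A\<in>sets borel. \<bar>m (F -` A) - m' A\<bar> \<le> \<epsilon>)" by blast
qed

section \<open>Limits of ReLU maps, in particular jump shears\<close>

definition limit_map :: "('a::euclidean_space \<Rightarrow> 'a) \<Rightarrow> bool" where
  "limit_map F \<longleftrightarrow> F \<in> borel_measurable borel \<and>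
     (\<forall>M. finite_measure M \<longrightarrow> sets M = sets borel \<longrightarrow> reach (measure M) (\<lambda>A. measure M (F -` A)))"

lemma limit_map_id: "limit_map (\<lambda>x. x)"
  by (auto simp: limit_map_def intro: reach_eqI)

text \<open>\<open>limit_map\<close> quantifies over all finite Borel measures, with approximations
  that may depend on the measure. Therefore the property of \<open>G\<close> can be applied to the
  pushforward \<open>N\<close> of \<open>M\<close> under \<open>F\<close>.\<close>

lemma limit_map_comp:
  assumes "limit_map F" "limit_map G"
  shows "limit_map (\<lambda>x. G (F x))"
  unfolding limit_map_def
proof (intro conjI allI impI)
  have [measurable]: "F \<in> borel_measurable borel" "G \<in> borel_measurable borel"
    using assms by (auto simp: limit_map_def)
  show "(\<lambda>x. G (F x)) \<in> borel_measurable borel" by measurable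
  fix M :: "'a measure" assume M: "finite_measure M" and [measurable_cong]: "sets M = sets borel"
  have sp: "space M = UNIV" using sets_eq_imp_space_eq[OF \<open>sets M = sets borel\<close>] by simp
  define N where "N = distr M borel F"
  have N: "finite_measure N" "sets N = sets borel"
    unfolding N_def by (auto intro!: finite_measure.finite_measure_distr[OF M])
  have mN: "measure N A = measure M (F -` A)" if "A \<in> sets borel" for A
    unfolding N_def using that by (subst measure_distr) (auto simp: sp)
  have Gv: "G -` A \<in> sets borel" if "A \<in> sets borel" for A
    using measurable_sets[of G borel borel A] that by simp
  have "reach (measure M) (\<lambda>A. measure M (F -` A))"
    using assms(1) M \<open>sets M = sets borel\<close> unfolding limit_map_def by blast
  also have "reach (\<lambda>A. measure M (F -` A)) (\<lambda>A. measure M ((\<lambda>x. G (F x)) -` A))"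
  proof -
    have "reach (measure N) (\<lambda>A. measure N (G -` A))"
      using assms(2) N unfolding limit_map_def by blast
    then show ?thesis
      by (subst (asm) reach_cong[where n = "\<lambda>A. measure M (F -` A)"
          and n' = "\<lambda>A. measure M ((\<lambda>x. G (F x)) -` A)"]) (auto simp: mN Gv vimage_def)
  qed
  finally show "reach (measure M) (\<lambda>A. measure M ((\<lambda>x. G (F x)) -` A))" .
qed

text \<open>The difference of two steep ReLU shears is a ramp that agrees with the jump outside the
  open strip \<open>D n\<close>. The ramp lies strictly below \<open>c\<close>, so the strips
  decrease to the empty set and their measure tends to 0 even if the hyperplane itself carries
  mass.\<close>

lemma limit_map_heaviside:
  fixes i j :: "'a::euclidean_space"
  assumes "i \<in> Basis" "j \<in> Basis" "i \<noteq> j"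
  shows "limit_map (\<lambda>x. x + (if c \<le> x \<bullet> j then v else 0) *\<^sub>R i)" (is "limit_map ?F")
  unfolding limit_map_def
proof (intro conjI allI impI)
  show F[measurable]: "?F \<in> borel_measurable borel" by measurable
  fix M :: "'a measure" assume M: "finite_measure M" and [measurable_cong]: "sets M = sets borel"
  interpret finite_measure M by fact
  have sp: "space M = UNIV" using sets_eq_imp_space_eq[OF \<open>sets M = sets borel\<close>] by simp
  define D where "D n = {x \<in> space M. c - 1 / real (Suc n) < x \<bullet> j \<and> x \<bullet> j < c}" for n
  have D[measurable]: "D n \<in> sets M" for n unfolding D_def by measurable
  have "(\<lambda>n. measure M (D n)) \<longlonglongrightarrow> measure M (\<Inter>n. D n)"
  proof (rule finite_Lim_measure_decseq)
    have "1 / real (Suc n) \<le> 1 / real (Suc m)" if "m \<le> n" for m n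
      using that by (intro divide_left_mono) auto
    then show "decseq D" unfolding D_def decseq_def by (force simp: sp)
  qed (use D in auto)
  moreover have "(\<Inter>n. D n) = {}"
  proof (rule ccontr)
    assume "(\<Inter>n. D n) \<noteq> {}"
    then obtain x where x: "\<And>n. x \<in> D n" by auto
    then have "c - x \<bullet> j > 0" by (auto simp: D_def)
    then obtain n where "1 / real (Suc n) < c - x \<bullet> j" using nat_approx_posE by blast
    with x[of n] show False by (auto simp: D_def)
  qed
  ultimately have lim: "(\<lambda>n. measure M (D n)) \<longlonglongrightarrow> 0" by simp
  show "reach (measure M) (\<lambda>A. measure M (?F -` A))"
    unfolding reach_def
  proof (intro allI impI)
    fix \<epsilon> :: real assume "\<epsilon> > 0"
    then obtain n where n: "measure M (D n) < \<epsilon>"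
      using order_tendstoD(2)[OF lim, of \<epsilon>] eventually_sequentially by auto
    define N where "N = real (Suc n)"
    have N: "N > 0" by (simp add: N_def)
    \<comment> \<open>The displacement rises from 0 to \<open>v\<close> over the width
      \<open>1 / N\<close> with slope \<open>v * N\<close>; the second shear cancels the slope from
      \<open>c\<close> on.\<close>
    define H where "H x = relu_step (- v * N) i j (- c) (relu_step (v * N) i j (1 / N - c) x)" for x
    have ij: "i \<bullet> j = 0" using assms by (simp add: inner_Basis)
    have H: "relu_map H"
      unfolding H_def[abs_def] using assms by (intro relu_map_comp[OF relu_map_step relu_map_step]) auto
    have eq: "H x = ?F x" if "x \<notin> D n" for x
    proof -
      have "H x = x + (v * (N * (relu (x \<bullet> j + (1 / N - c)) - relu (x \<bullet> j - c)))) *\<^sub>R i"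
        unfolding H_def relu_step_def by (simp add: inner_add_left ij algebra_simps)
      moreover have "N * (relu (x \<bullet> j + (1 / N - c)) - relu (x \<bullet> j - c)) = (if c \<le> x \<bullet> j then 1 else 0)"
      proof (cases "c \<le> x \<bullet> j")
        case True
        moreover have "1 / N > 0" using N by simp
        ultimately have "relu (x \<bullet> j + (1 / N - c)) - relu (x \<bullet> j - c) = 1 / N"
          unfolding relu_def by linarith
        then show ?thesis using True N by simp
      next
        case False
        then have "x \<bullet> j + (1 / N - c) \<le> 0" using that by (simp add: D_def sp N_def)
        then show ?thesis using False by (simp add: relu_def)
      qed
      ultimately show ?thesis by auto
    qed
    have "\<bar>measure M (H -` A) - measure M (?F -` A)\<bar> \<le> \<epsilon>" if A: "A \<in> sets borel" for A
    proof -
      have [measurable]: "H -` A \<in> sets M" "?F -` A \<in> sets M"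
        using relu_map_vimage_borel[OF H A] measurable_sets[OF F A] by (auto simp: \<open>sets M = sets borel\<close>)
      have le: "measure M X \<le> measure M Y + measure M (D n)"
        if "X \<in> sets M" "Y \<in> sets M" "X \<subseteq> Y \<union> D n" for X Y
      proof -
        have "measure M X \<le> measure M (Y \<union> D n)" using that D by (intro finite_measure_mono) auto
        also have "\<dots> \<le> measure M Y + measure M (D n)" using that D by (intro measure_Un_le) auto
        finally show ?thesis .
      qed
      have "H -` A \<subseteq> ?F -` A \<union> D n" "?F -` A \<subseteq> H -` A \<union> D n" using eq by fastforce+
      from le[OF _ _ this(1)] le[OF _ _ this(2)] n show ?thesis by simp
    qed
    with H show "\<exists>F. relu_map F \<and> (\<forall>A\<in>sets borel. \<bar>measure M (F -` A) - measure M (?F -` A)\<bar> \<le> \<epsilon>)"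
      by blast
  qed
qed

text \<open>Each layer is handled by a jump of height \<open>g m\<close> at its lower face and the
  opposite jump at its upper face. Displacements along \<open>i\<close> do not affect
  \<open>x \<bullet> j\<close>, so the contributions of the layers add.\<close>

lemma limit_map_staircase:
  fixes i j :: "'a::euclidean_space"
  assumes "i \<in> Basis" "j \<in> Basis" "i \<noteq> j" "\<delta> > 0" "finite S"
  shows "limit_map (\<lambda>x. x + (if \<lfloor>x \<bullet> j / \<delta>\<rfloor> \<in> S then g \<lfloor>x \<bullet> j / \<delta>\<rfloor> else 0) *\<^sub>R i)"
  using assms(5)
proof induction
  case empty
  show ?case using limit_map_id by simp
next
  case (insert m S)
  have ij: "i \<bullet> j = 0" using assms by (simp add: inner_Basis)
  let ?H = "\<lambda>c v x. x + (if c \<le> x \<bullet> j then v else 0) *\<^sub>R i"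
  let ?F = "\<lambda>x. x + (if \<lfloor>x \<bullet> j / \<delta>\<rfloor> \<in> S then g \<lfloor>x \<bullet> j / \<delta>\<rfloor> else 0) *\<^sub>R i"
  have "limit_map (\<lambda>x. ?H (\<delta> * (m + 1)) (- g m) (?H (\<delta> * m) (g m) (?F x)))"
    by (rule limit_map_comp[OF limit_map_comp[OF insert.IH limit_map_heaviside[OF assms(1-3)]]
          limit_map_heaviside[OF assms(1-3)]])
  also have "(\<lambda>x. ?H (\<delta> * (m + 1)) (- g m) (?H (\<delta> * m) (g m) (?F x))) =
    (\<lambda>x. x + (if \<lfloor>x \<bullet> j / \<delta>\<rfloor> \<in> insert m S then g \<lfloor>x \<bullet> j / \<delta>\<rfloor> else 0) *\<^sub>R i)"
  proof
    fix x
    have 1: "\<delta> * m \<le> x \<bullet> j \<longleftrightarrow> m \<le> \<lfloor>x \<bullet> j / \<delta>\<rfloor>"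
      using assms(4) by (simp add: le_floor_iff field_simps)
    have 2: "\<delta> * (m + 1) \<le> x \<bullet> j \<longleftrightarrow> m + 1 \<le> \<lfloor>x \<bullet> j / \<delta>\<rfloor>"
      using assms(4) by (simp add: le_floor_iff field_simps)
    have "?H (\<delta> * (m + 1)) (- g m) (?H (\<delta> * m) (g m) (?F x)) =
       x + ((if \<lfloor>x \<bullet> j / \<delta>\<rfloor> \<in> S then g \<lfloor>x \<bullet> j / \<delta>\<rfloor> else 0) + (if m \<le> \<lfloor>x \<bullet> j / \<delta>\<rfloor> then g m else 0)
          + (if m + 1 \<le> \<lfloor>x \<bullet> j / \<delta>\<rfloor> then - g m else 0)) *\<^sub>R i"
      unfolding inner_add_left inner_scaleR_left ij mult_zero_right add_0_right 1 2
      by (simp only: scaleR_add_left add.assoc)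
    also have "(if \<lfloor>x \<bullet> j / \<delta>\<rfloor> \<in> S then g \<lfloor>x \<bullet> j / \<delta>\<rfloor> else 0) + (if m \<le> \<lfloor>x \<bullet> j / \<delta>\<rfloor> then g m else 0)
          + (if m + 1 \<le> \<lfloor>x \<bullet> j / \<delta>\<rfloor> then - g m else 0) =
       (if \<lfloor>x \<bullet> j / \<delta>\<rfloor> \<in> insert m S then g \<lfloor>x \<bullet> j / \<delta>\<rfloor> else 0)"
    proof -
      have "k \<in> S \<Longrightarrow> k \<noteq> m" for k using insert.hyps by auto
      then show ?thesis by (cases "m = \<lfloor>x \<bullet> j / \<delta>\<rfloor>") auto
    qed
    finally show "?H (\<delta> * (m + 1)) (- g m) (?H (\<delta> * m) (g m) (?F x)) =
       x + (if \<lfloor>x \<bullet> j / \<delta>\<rfloor> \<in> insert m S then g \<lfloor>x \<bullet> j / \<delta>\<rfloor> else 0) *\<^sub>R i" .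
  qed
  finally show ?case .
qed

text \<open>The uniform distribution on \<open>B\<close>; it is \<open>0\<close> if \<open>B\<close> has measure \<open>0\<close>.\<close>
definition unif :: "'a::euclidean_space set \<Rightarrow> 'a set \<Rightarrow> real" where
  "unif B A = measure lborel (B \<inter> A) / measure lborel B"

section \<open>Mixtures of uniform distributions on boxes\<close>

lemma measure_density_lborel:
  fixes f :: "'a::euclidean_space \<Rightarrow> real"
  assumes f: "integrable lborel f" "AE x in lborel. 0 \<le> f x" and A: "A \<in> sets borel"
  shows "measure (density lborel (\<lambda>x. ennreal (f x))) A = (\<integral>x. f x * indicator A x \<partial>lborel)"
proof -
  have "measure (density lborel (\<lambda>x. ennreal (f x))) A
      = (\<integral>x. indicator A x \<partial>density lborel (\<lambda>x. ennreal (f x)))"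
    using A by simp
  also have "\<dots> = (\<integral>x. f x * indicator A x \<partial>lborel)"
    using f A by (subst integral_real_density) auto
  finally show ?thesis .
qed

lemma finite_measure_density_lborel:
  fixes f :: "'a::euclidean_space \<Rightarrow> real"
  assumes f: "integrable lborel f" "AE x in lborel. 0 \<le> f x"
  shows "finite_measure (density lborel (\<lambda>x. ennreal (f x)))"
proof (rule finite_measureI)
  have "emeasure (density lborel (\<lambda>x. ennreal (f x))) (space lborel) = (\<integral>\<^sup>+x. ennreal (f x) \<partial>lborel)"
    using f by (subst emeasure_density) auto
  also have "\<dots> = ennreal (\<integral>x. f x \<partial>lborel)" using f by (rule nn_integral_eq_integral)
  finally show "emeasure (density lborel (\<lambda>x. ennreal (f x))) (space (density lborel (\<lambda>x. ennreal (f x)))) \<noteq> \<infinity>"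
    by simp
qed

text \<open>Mixtures are treated as set functions, whereas \<open>limit_map\<close> speaks about
  measures; this supplies a measure representing the mixture.\<close>

lemma unif_mixture_measure:
  fixes B :: "'k \<Rightarrow> 'a::euclidean_space set"
  assumes "finite K" "\<And>k. k \<in> K \<Longrightarrow> c k \<ge> 0" "\<And>k. k \<in> K \<Longrightarrow> B k \<in> fmeasurable lborel"
  shows "\<exists>M. finite_measure M \<and> sets M = sets borel \<and>
    (\<forall>A\<in>sets borel. measure M A = (\<Sum>k\<in>K. c k * unif (B k) A))"
proof -
  \<comment> \<open>For a null set \<open>B k\<close> the quotient is 0 by the convention for
    division, in agreement with \<open>unif\<close>.\<close>
  define f where "f x = (\<Sum>k\<in>K. c k / measure lborel (B k) * indicator (B k) x)" for x
  have int: "integrable lborel (\<lambda>x. c k / measure lborel (B k) * indicator (B k) x)" if "k \<in> K" for k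
    using assms(3)[OF that] by (auto simp: fmeasurable_def)
  have f: "integrable lborel f" unfolding f_def using int by (intro Bochner_Integration.integrable_sum)
  have nn: "AE x in lborel. 0 \<le> f x" using assms by (auto simp: f_def intro!: sum_nonneg)
  have "measure (density lborel (\<lambda>x. ennreal (f x))) A = (\<Sum>k\<in>K. c k * unif (B k) A)"
    if A: "A \<in> sets borel" for A
  proof -
    have "measure (density lborel (\<lambda>x. ennreal (f x))) A = (\<integral>x. f x * indicator A x \<partial>lborel)"
      by (rule measure_density_lborel[OF f nn A])
    also have "\<dots> = (\<integral>x. (\<Sum>k\<in>K. c k / measure lborel (B k) * indicator (B k \<inter> A) x) \<partial>lborel)"
      by (simp add: f_def sum_distrib_right indicator_inter_arith mult.assoc)
    also have "\<dots> = (\<Sum>k\<in>K. \<integral>x. c k / measure lborel (B k) * indicator (B k \<inter> A) x \<partial>lborel)"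
    proof (rule Bochner_Integration.integral_sum)
      fix k assume "k \<in> K"
      then have "B k \<inter> A \<in> fmeasurable lborel"
        using A assms(3) by (intro fmeasurable_Int_fmeasurable) auto
      then show "integrable lborel (\<lambda>x. c k / measure lborel (B k) * indicator (B k \<inter> A) x)"
        by (auto simp: fmeasurable_def)
    qed
    also have "\<dots> = (\<Sum>k\<in>K. c k * unif (B k) A)"
      by (intro sum.cong) (auto simp: unif_def)
    finally show ?thesis .
  qed
  with finite_measure_density_lborel[OF f nn] show ?thesis by (intro exI) auto
qed

lemma reach_mixture_limit_map:
  fixes B :: "'k \<Rightarrow> 'a::euclidean_space set"
  assumes "limit_map F" "finite K" "\<And>k. k \<in> K \<Longrightarrow> c k \<ge> 0" "\<And>k. k \<in> K \<Longrightarrow> B k \<in> fmeasurable lborel"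
  shows "reach (\<lambda>A. \<Sum>k\<in>K. c k * unif (B k) A) (\<lambda>A. \<Sum>k\<in>K. c k * unif (B k) (F -` A))"
proof -
  obtain M where M: "finite_measure M" "sets M = sets borel"
    "\<And>A. A\<in>sets borel \<Longrightarrow> measure M A = (\<Sum>k\<in>K. c k * unif (B k) A)"
    using unif_mixture_measure[of K c B] assms by blast
  have "F -` A \<in> sets borel" if "A \<in> sets borel" for A
    using assms(1) measurable_sets[of F borel borel A] that by (simp add: limit_map_def)
  moreover have "reach (measure M) (\<lambda>A. measure M (F -` A))"
    using assms(1) M unfolding limit_map_def by blast
  ultimately show ?thesis
    by (subst (asm) reach_cong[where n = "\<lambda>A. \<Sum>k\<in>K. c k * unif (B k) A"
          and n' = "\<lambda>A. \<Sum>k\<in>K. c k * unif (B k) (F -` A)"]) (auto simp: M(3))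
qed

text \<open>Half-open boxes tile space without overlap, and the floor function identifies the tile
  of a point. Bounds indexed by basis vectors allow one coordinate to be changed by a function
  update.\<close>

definition hbox :: "('a::euclidean_space \<Rightarrow> real) \<Rightarrow> ('a \<Rightarrow> real) \<Rightarrow> 'a set" where
  "hbox l u = {x. \<forall>i\<in>Basis. l i \<le> x \<bullet> i \<and> x \<bullet> i < u i}"

lemma hbox_borel [measurable]: "hbox l u \<in> sets borel"
  unfolding hbox_def by measurable

lemma hbox_subset_cbox:
  "hbox l u \<subseteq> cbox (\<Sum>i\<in>Basis. l i *\<^sub>R i) (\<Sum>i\<in>Basis. u i *\<^sub>R i)"
  by (auto simp: hbox_def mem_box less_imp_le)

lemma box_subset_hbox:
  "box (\<Sum>i\<in>Basis. l i *\<^sub>R i) (\<Sum>i\<in>Basis. u i *\<^sub>R i) \<subseteq> hbox l u"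
  by (auto simp: hbox_def mem_box less_imp_le)

lemma hbox_fmeasurable: "hbox l u \<in> fmeasurable lborel"
  by (rule fmeasurableI2[OF fmeasurable_cbox hbox_subset_cbox]) simp

lemma measure_hbox:
  assumes "\<And>i. i \<in> Basis \<Longrightarrow> l i \<le> u i"
  shows "measure lborel (hbox l u :: 'a::euclidean_space set) = (\<Prod>i\<in>Basis. u i - l i)"
proof (rule antisym)
  let ?l = "\<Sum>i\<in>Basis. l i *\<^sub>R i :: 'a" and ?u = "\<Sum>i\<in>Basis. u i *\<^sub>R i :: 'a"
  have "measure lborel (hbox l u) \<le> measure lborel (cbox ?l ?u)"
    by (intro measure_mono_fmeasurable hbox_subset_cbox) auto
  also have "\<dots> = (\<Prod>i\<in>Basis. u i - l i)"
    using assms by (simp add: measure_lborel_cbox_eq inner_diff_left)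
  finally show "measure lborel (hbox l u) \<le> (\<Prod>i\<in>Basis. u i - l i)" .
  have "(\<Prod>i\<in>Basis. u i - l i) = measure lborel (box ?l ?u)"
    using assms by (simp add: measure_lborel_box_eq inner_diff_left)
  also have "\<dots> \<le> measure lborel (hbox l u)"
    by (intro measure_mono_fmeasurable box_subset_hbox hbox_fmeasurable) auto
  finally show "(\<Prod>i\<in>Basis. u i - l i) \<le> measure lborel (hbox l u)" .
qed

text \<open>On the box, \<open>F\<close> is an affine map acting only on coordinate
  \<open>i\<close>, with positive factor \<open>1 + \<beta>\<close>. Such a map takes boxes to boxes
  and scales all volumes by the same constant, which cancels in \<open>unif\<close>. The case
  \<open>\<beta> = 0\<close> covers translations.\<close>

lemma unif_hbox_affine:
  fixes F :: "'a::euclidean_space \<Rightarrow> 'a"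
  assumes i: "i \<in> Basis" and \<beta>: "\<beta> > -1"
    and F: "\<And>x. x \<in> hbox l u \<Longrightarrow> F x = x + (\<alpha> + \<beta> * (x \<bullet> i)) *\<^sub>R i"
    and l': "l' = l(i := l i + (\<alpha> + \<beta> * l i))" and u': "u' = u(i := u i + (\<alpha> + \<beta> * u i))"
    and A: "A \<in> sets borel"
  shows "unif (hbox l u) (F -` A) = unif (hbox l' u') A"
proof -
  \<comment> \<open>\<open>T\<close> is the affine map on the whole space, with diagonal linear part
    \<open>c\<close>; \<open>F\<close> is only known to agree with it on the box.\<close>
  define c where "c j = (if j = i then 1 + \<beta> else 1)" for j :: 'a
  define T where "T x = \<alpha> *\<^sub>R i + (\<Sum>j\<in>Basis. (c j * (x \<bullet> j)) *\<^sub>R j)" for x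
  have T: "T x = x + (\<alpha> + \<beta> * (x \<bullet> i)) *\<^sub>R i" for x
    by (rule euclidean_eqI) (auto simp: T_def c_def inner_add_left inner_Basis i algebra_simps)
  define k where "k = (\<Prod>j\<in>Basis. \<bar>c j\<bar> :: real)"
  have k: "k > 0" unfolding k_def c_def using \<beta> by (intro prod_pos) auto
  have "lborel = density (distr lborel borel T) (\<lambda>_. k)"
    unfolding T_def k_def using \<beta> by (intro lborel_affine_euclidean) (auto simp: c_def)
  have [measurable]: "T \<in> borel_measurable borel" unfolding T_def by measurable
  have vol: "measure lborel X = k * measure lborel (T -` X)" if "X \<in> sets borel" for X
  proof -
    have "emeasure lborel X = emeasure (density (distr lborel borel T) (\<lambda>_. k)) X"
      using \<open>lborel = _\<close> by simp
    also have "\<dots> = ennreal k * emeasure lborel (T -` X)"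
      using that by (simp add: emeasure_density nn_integral_cmult emeasure_distr)
    finally show ?thesis using k by (simp add: measure_def enn2real_mult)
  qed
  have lu: "hbox l u = T -` hbox l' u'"
  proof -
    have "x \<bullet> i + (\<alpha> + \<beta> * (x \<bullet> i)) < u i + (\<alpha> + \<beta> * u i) \<longleftrightarrow> x \<bullet> i < u i"
         "l i + (\<alpha> + \<beta> * l i) \<le> x \<bullet> i + (\<alpha> + \<beta> * (x \<bullet> i)) \<longleftrightarrow> l i \<le> x \<bullet> i" for x
    proof -
      have *: "y + (\<alpha> + \<beta> * y) = (1 + \<beta>) * y + \<alpha>" for y by (simp add: algebra_simps)
      show "x \<bullet> i + (\<alpha> + \<beta> * (x \<bullet> i)) < u i + (\<alpha> + \<beta> * u i) \<longleftrightarrow> x \<bullet> i < u i"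
         "l i + (\<alpha> + \<beta> * l i) \<le> x \<bullet> i + (\<alpha> + \<beta> * (x \<bullet> i)) \<longleftrightarrow> l i \<le> x \<bullet> i"
        unfolding * using \<beta> by simp_all
    qed
    moreover have "T x \<bullet> j = (if j = i then x \<bullet> i + (\<alpha> + \<beta> * (x \<bullet> i)) else x \<bullet> j)" if "j \<in> Basis" for j x
      using that i by (simp add: T inner_add_left inner_Basis)
    ultimately show ?thesis
      by (auto simp: hbox_def l' u' split: if_splits)
  qed
  have "hbox l u \<inter> F -` A = T -` (hbox l' u' \<inter> A)"
    using F by (auto simp: lu T)
  moreover have "measure lborel (hbox l' u' \<inter> A) = k * measure lborel (T -` (hbox l' u' \<inter> A))"
    using A by (intro vol) auto
  moreover have "measure lborel (hbox l' u') = k * measure lborel (T -` (hbox l' u'))"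
    using A by (intro vol) auto
  ultimately show ?thesis using k by (simp add: unif_def lu)
qed

section \<open>From grid cells to the unit cube\<close>

definition cell :: "real \<Rightarrow> ('a::euclidean_space \<Rightarrow> int) \<Rightarrow> 'a set" where
  "cell \<delta> p = hbox (\<lambda>i. \<delta> * p i) (\<lambda>i. \<delta> * p i + \<delta>)"

lemma floor_cell:
  assumes "x \<in> cell \<delta> p" "\<delta> > 0" "j \<in> Basis"
  shows "\<lfloor>x \<bullet> j / \<delta>\<rfloor> = p j"
proof -
  have "\<delta> * p j \<le> x \<bullet> j" "x \<bullet> j < \<delta> * p j + \<delta>"
    using assms by (auto simp: cell_def hbox_def)
  then show ?thesis using assms(2) by (intro floor_unique) (auto simp: field_simps)
qed

text \<open>The displacement depends only on the layer in direction \<open>j\<close>, so it is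
  constant on each cell; being a multiple of \<open>\<delta>\<close>, it moves the cell to another
  grid cell.\<close>

lemma reach_shift_cells:
  fixes p :: "'k \<Rightarrow> 'a::euclidean_space \<Rightarrow> int"
  assumes ij: "i \<in> Basis" "j \<in> Basis" "i \<noteq> j" and \<delta>: "\<delta> > 0"
    and K: "finite K" "\<And>k. k \<in> K \<Longrightarrow> c k \<ge> 0"
  shows "reach (\<lambda>A. \<Sum>k\<in>K. c k * unif (cell \<delta> (p k)) A)
           (\<lambda>A. \<Sum>k\<in>K. c k * unif (cell \<delta> ((p k)(i := p k i + g (p k j)))) A)"
proof -
  define S where "S = (\<lambda>k. p k j) ` K"
  define F where "F x = x + (if \<lfloor>x \<bullet> j / \<delta>\<rfloor> \<in> S then \<delta> * g \<lfloor>x \<bullet> j / \<delta>\<rfloor> else 0) *\<^sub>R i" for x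
  have F: "limit_map F"
    unfolding F_def[abs_def] using K ij \<delta> by (intro limit_map_staircase) (auto simp: S_def)
  have "reach (\<lambda>A. \<Sum>k\<in>K. c k * unif (cell \<delta> (p k)) A) (\<lambda>A. \<Sum>k\<in>K. c k * unif (cell \<delta> (p k)) (F -` A))"
    using K by (intro reach_mixture_limit_map F) (auto simp: cell_def hbox_fmeasurable)
  also have "reach (\<lambda>A. \<Sum>k\<in>K. c k * unif (cell \<delta> (p k)) (F -` A))
     (\<lambda>A. \<Sum>k\<in>K. c k * unif (cell \<delta> ((p k)(i := p k i + g (p k j)))) A)"
  proof (intro reach_eqI sum.cong refl)
    fix A :: "'a set" and k assume A: "A \<in> sets borel" and k: "k \<in> K"
    have "F x = x + (\<delta> * g (p k j) + 0 * (x \<bullet> i)) *\<^sub>R i" if "x \<in> cell \<delta> (p k)" for x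
      using floor_cell[OF that \<delta> ij(2)] k by (simp add: F_def S_def)
    then have "unif (cell \<delta> (p k)) (F -` A) = unif (cell \<delta> ((p k)(i := p k i + g (p k j)))) A"
      unfolding cell_def
      by (intro unif_hbox_affine[where \<alpha> = "\<delta> * g (p k j)" and \<beta> = 0 and i = i] ij A)
        (auto simp: fun_eq_iff algebra_simps)
    then show "c k * unif (cell \<delta> (p k)) (F -` A) = c k * unif (cell \<delta> ((p k)(i := p k i + g (p k j)))) A"
      by simp
  qed
  finally show ?thesis .
qed

text \<open>The new \<open>e\<close>-coordinate encodes the coordinates in \<open>S\<close> like
  digits in a positional system, one more digit in each induction step. The other coordinates stay
  as they were, so the later digits can still be read off from \<open>p\<close>.\<close>

lemma reach_separate_cells:
  fixes p :: "'k \<Rightarrow> 'a::euclidean_space \<Rightarrow> int"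
  assumes e: "e \<in> Basis" and \<delta>: "\<delta> > 0" and K: "finite K" "\<And>k. k \<in> K \<Longrightarrow> c k \<ge> 0"
    and S: "finite S" "S \<subseteq> Basis - {e}"
  shows "\<exists>p'. reach (\<lambda>A. \<Sum>k\<in>K. c k * unif (cell \<delta> (p k)) A) (\<lambda>A. \<Sum>k\<in>K. c k * unif (cell \<delta> (p' k)) A)
     \<and> (\<forall>k i. i \<noteq> e \<longrightarrow> p' k i = p k i)
     \<and> (\<forall>k\<in>K. \<forall>k'\<in>K. (\<exists>i\<in>insert e S. p k i \<noteq> p k' i) \<longrightarrow> p' k e \<noteq> p' k' e)"
  using S
proof (induction S rule: finite_induct)
  case empty
  show ?case by (intro exI[of _ p]) (auto intro: reach_eqI)
next
  case (insert s S)
  then obtain p' where p':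
    "reach (\<lambda>A. \<Sum>k\<in>K. c k * unif (cell \<delta> (p k)) A) (\<lambda>A. \<Sum>k\<in>K. c k * unif (cell \<delta> (p' k)) A)"
    "\<And>k i. i \<noteq> e \<Longrightarrow> p' k i = p k i"
    "\<And>k k'. \<lbrakk>k \<in> K; k' \<in> K; \<exists>i\<in>insert e S. p k i \<noteq> p k' i\<rbrakk> \<Longrightarrow> p' k e \<noteq> p' k' e"
    by auto
  define B where "B = (\<Sum>k\<in>K. \<bar>p' k e\<bar>)"
  have B: "\<bar>p' k e\<bar> \<le> B" if "k \<in> K" for k
    unfolding B_def using K that by (intro member_le_sum) auto
  have s: "s \<in> Basis" "s \<noteq> e" using insert by auto
  \<comment> \<open>Old \<open>e\<close>-coordinates differ by at most \<open>2 * B\<close>, so with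
    weight \<open>2 * B + 1\<close> any difference in the digit \<open>s\<close> outweighs them. For
    equal digits the old difference survives.\<close>
  define p'' where "p'' k = (p' k)(e := p' k e + (2 * B + 1) * p' k s)" for k
  have r: "reach (\<lambda>A. \<Sum>k\<in>K. c k * unif (cell \<delta> (p' k)) A) (\<lambda>A. \<Sum>k\<in>K. c k * unif (cell \<delta> (p'' k)) A)"
    unfolding p''_def using s by (intro reach_shift_cells e \<delta> K) auto
  have "p'' k e \<noteq> p'' k' e"
    if k: "k \<in> K" "k' \<in> K" and ex: "\<exists>i\<in>insert e (insert s S). p k i \<noteq> p k' i" for k k'
  proof (cases "p k s = p k' s")
    case True
    then have "p' k e \<noteq> p' k' e" using ex k by (intro p'(3)) auto
    then show ?thesis using True s by (simp add: p''_def p'(2))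
  next
    case False
    then have "\<bar>p k s - p k' s\<bar> \<ge> 1" by linarith
    moreover have "B \<ge> 0" unfolding B_def by (intro sum_nonneg) auto
    ultimately have "2 * B + 1 \<le> \<bar>(2 * B + 1) * (p k s - p k' s)\<bar>"
      using mult_left_mono[of 1 "\<bar>p k s - p k' s\<bar>" "2 * B + 1"] by (simp add: abs_mult)
    moreover have "\<bar>p' k e - p' k' e\<bar> \<le> 2 * B" using B[OF k(1)] B[OF k(2)] by linarith
    moreover have "p'' k e - p'' k' e = (p' k e - p' k' e) + (2 * B + 1) * (p k s - p k' s)"
      using s by (simp add: p''_def p'(2) algebra_simps)
    ultimately show ?thesis by linarith
  qed
  moreover have "\<forall>k i. i \<noteq> e \<longrightarrow> p'' k i = p k i" by (simp add: p''_def p'(2))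
  ultimately show ?case using reach_trans[OF p'(1) r] by (intro exI[of _ p'']) blast
qed

text \<open>As the \<open>e\<close>-coordinate determines the cell, a displacement that depends on
  it alone can be prescribed for each cell separately. One coordinate after the other is thus moved
  to 0.\<close>

lemma reach_flatten_cells:
  fixes p :: "'k \<Rightarrow> 'a::euclidean_space \<Rightarrow> int"
  assumes e: "e \<in> Basis" and \<delta>: "\<delta> > 0" and K: "finite K" "\<And>k. k \<in> K \<Longrightarrow> c k \<ge> 0"
    and inj: "inj_on (\<lambda>k. p k e) K"
    and S: "finite S" "S \<subseteq> Basis - {e}"
  shows "reach (\<lambda>A. \<Sum>k\<in>K. c k * unif (cell \<delta> (p k)) A)
           (\<lambda>A. \<Sum>k\<in>K. c k * unif (cell \<delta> (\<lambda>i. if i \<in> S then 0 else p k i)) A)"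
  using S
proof (induction S rule: finite_induct)
  case empty
  show ?case by (auto intro: reach_eqI)
next
  case (insert s S)
  define q where "q k i = (if i \<in> S then 0 else p k i)" for k i
  \<comment> \<open>\<open>g\<close> recovers the cell from its \<open>e\<close>-coordinate and
    cancels its coordinate \<open>s\<close>.\<close>
  define g where "g m = - p (inv_into K (\<lambda>k. p k e) m) s" for m
  have s: "s \<in> Basis" "s \<noteq> e" "e \<notin> S" using insert by auto
  have "reach (\<lambda>A. \<Sum>k\<in>K. c k * unif (cell \<delta> (p k)) A) (\<lambda>A. \<Sum>k\<in>K. c k * unif (cell \<delta> (q k)) A)"
    unfolding q_def using insert by auto
  also have "reach (\<lambda>A. \<Sum>k\<in>K. c k * unif (cell \<delta> (q k)) A)
       (\<lambda>A. \<Sum>k\<in>K. c k * unif (cell \<delta> ((q k)(s := q k s + g (q k e)))) A)"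
    using s by (intro reach_shift_cells e \<delta> K) auto
  also have "(\<lambda>A. \<Sum>k\<in>K. c k * unif (cell \<delta> ((q k)(s := q k s + g (q k e)))) A)
      = (\<lambda>A. \<Sum>k\<in>K. c k * unif (cell \<delta> (\<lambda>i. if i \<in> insert s S then 0 else p k i)) A)"
  proof (intro ext sum.cong refl)
    fix A k assume k: "k \<in> K"
    have "inv_into K (\<lambda>k. p k e) (p k e) = k" using inv_into_f_f[OF inj k] by simp
    then have "(q k)(s := q k s + g (q k e)) = (\<lambda>i. if i \<in> insert s S then 0 else p k i)"
      using s insert.hyps by (auto simp: q_def g_def fun_eq_iff)
    then show "c k * unif (cell \<delta> ((q k)(s := q k s + g (q k e)))) A
        = c k * unif (cell \<delta> (\<lambda>i. if i \<in> insert s S then 0 else p k i)) A" by simp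
  qed
  finally show ?case .
qed

lemma cell_cong: "(\<And>i. i \<in> Basis \<Longrightarrow> p i = q i) \<Longrightarrow> cell \<delta> p = cell \<delta> q"
  by (auto simp: cell_def hbox_def)

text \<open>Separation followed by flattening. In dimension one there are no other directions, and
  the cells already form a row.\<close>

lemma reach_line_up_cells:
  fixes p :: "'k \<Rightarrow> 'a::euclidean_space \<Rightarrow> int"
  assumes e: "e \<in> Basis" and \<delta>: "\<delta> > 0" and K: "finite K" "\<And>k. k \<in> K \<Longrightarrow> c k \<ge> 0"
    and inj: "\<And>k k'. \<lbrakk>k \<in> K; k' \<in> K; k \<noteq> k'\<rbrakk> \<Longrightarrow> \<exists>i\<in>Basis. p k i \<noteq> p k' i"
  shows "\<exists>N. inj_on N K \<and> reach (\<lambda>A. \<Sum>k\<in>K. c k * unif (cell \<delta> (p k)) A)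
           (\<lambda>A. \<Sum>k\<in>K. c k * unif (cell \<delta> (\<lambda>i. if i = e then N k else 0)) A)"
proof -
  let ?S = "Basis - {e}"
  obtain p' where p':
    "reach (\<lambda>A. \<Sum>k\<in>K. c k * unif (cell \<delta> (p k)) A) (\<lambda>A. \<Sum>k\<in>K. c k * unif (cell \<delta> (p' k)) A)"
    "\<forall>k\<in>K. \<forall>k'\<in>K. (\<exists>i\<in>insert e ?S. p k i \<noteq> p k' i) \<longrightarrow> p' k e \<noteq> p' k' e"
    using reach_separate_cells[of e \<delta> K c ?S p] e \<delta> K by auto
  have inj': "inj_on (\<lambda>k. p' k e) K"
  proof (rule inj_onI, rule ccontr)
    fix k k' assume k: "k \<in> K" "k' \<in> K" "p' k e = p' k' e" "k \<noteq> k'"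
    moreover have "insert e ?S = Basis" using e by auto
    ultimately show False using p'(2) inj[of k k'] by metis
  qed
  have "reach (\<lambda>A. \<Sum>k\<in>K. c k * unif (cell \<delta> (p k)) A) (\<lambda>A. \<Sum>k\<in>K. c k * unif (cell \<delta> (p' k)) A)"
    by (rule p')
  also have "reach \<dots> (\<lambda>A. \<Sum>k\<in>K. c k * unif (cell \<delta> (\<lambda>i. if i \<in> ?S then 0 else p' k i)) A)"
    by (rule reach_flatten_cells[of e \<delta> K c p', OF e \<delta> K inj']) auto
  also have "(\<lambda>A. \<Sum>k\<in>K. c k * unif (cell \<delta> (\<lambda>i. if i \<in> ?S then 0 else p' k i)) A)
     = (\<lambda>A. \<Sum>k\<in>K. c k * unif (cell \<delta> (\<lambda>i. if i = e then p' k e else 0)) A)"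
  proof -
    have "cell \<delta> (\<lambda>i. if i \<in> ?S then 0 else p' k i) = cell \<delta> (\<lambda>i. if i = e then p' k e else 0)" for k
      by (rule cell_cong) auto
    then show ?thesis by simp
  qed
  finally show ?thesis using inj' by (intro exI[of _ "\<lambda>k. p' k e"]) auto
qed

section \<open>Stretching boxes and merging slabs\<close>

lemma unif_stretch_beyond:
  fixes e :: "'a::euclidean_space"
  assumes e: "e \<in> Basis" and r: "r > 0" and s: "s \<le> l e" and A: "A \<in> sets borel"
  shows "unif (hbox l u) (relu_step (r - 1) e e (- s) -` A) =
    unif (hbox (l(e := s + r * (l e - s))) (u(e := s + r * (u e - s)))) A"
proof (rule unif_hbox_affine[where \<alpha> = "- (r - 1) * s" and \<beta> = "r - 1" and i = e])
  fix x assume "x \<in> hbox l u"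
  then have "x \<bullet> e - s \<ge> 0" using e s by (auto simp: hbox_def)
  then have relu: "relu (x \<bullet> e + - s) = x \<bullet> e - s" by (simp add: relu_def)
  show "relu_step (r - 1) e e (- s) x = x + (- (r - 1) * s + (r - 1) * (x \<bullet> e)) *\<^sub>R e"
    unfolding relu_step_def relu by (simp add: algebra_simps)
qed (use e r A in \<open>auto simp: fun_eq_iff algebra_simps\<close>)

lemma unif_stretch_before:
  fixes e :: "'a::euclidean_space"
  assumes e: "e \<in> Basis" and s: "u e \<le> s" and A: "A \<in> sets borel"
  shows "unif (hbox l u) (relu_step c e e (- s) -` A) = unif (hbox l u) A"
proof (rule unif_hbox_affine[where \<alpha> = 0 and \<beta> = 0 and i = e])
  fix x assume "x \<in> hbox l u"
  then have "x \<bullet> e < s" using e s by (force simp: hbox_def)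
  then have "relu (x \<bullet> e + - s) = 0" by (simp add: relu_def)
  then show "relu_step c e e (- s) x = x + (0 + 0 * (x \<bullet> e)) *\<^sub>R e"
    unfolding relu_step_def by simp
qed (use e A in auto)

lemma reach_stretch:
  fixes e :: "'a::euclidean_space"
  assumes e: "e \<in> Basis" and r: "r > 0" and s: "s \<le> l e"
  shows "reach (\<lambda>A. C * unif (hbox l u) A)
    (\<lambda>A. C * unif (hbox (l(e := s + r * (l e - s))) (u(e := s + r * (u e - s)))) A)"
proof -
  have "reach (\<lambda>A. C * unif (hbox l u) A) (\<lambda>A. C * unif (hbox l u) (relu_step (r - 1) e e (- s) -` A))"
    using e r by (intro reach_relu_map relu_map_step) auto
  then show ?thesis
    by (subst (asm) reach_cong[OF refl]) (auto simp: unif_stretch_beyond[of e r s l, OF e r s])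
qed

text \<open>Two stretchings replace a translation, so this also works in dimension one: the first,
  about a point \<open>s\<close> below the box, moves the lower face to 0, and the second, about 0,
  moves the upper face to 1.\<close>

lemma reach_normalize_coordinate:
  fixes e :: "'a::euclidean_space"
  assumes e: "e \<in> Basis" and lu: "l e < u e"
  shows "reach (\<lambda>A. C * unif (hbox l u) A) (\<lambda>A. C * unif (hbox (l(e := 0)) (u(e := 1))) A)"
proof -
  \<comment> \<open>\<open>s\<close> must lie below \<open>l e\<close>, so that the box is in the
    stretched half-space, and below 0, so that the factor \<open>r\<close> taking \<open>l e\<close>
    to 0 is positive.\<close>
  define s where "s = min (l e) 0 - 1"
  define r where "r = - s / (l e - s)"
  have s: "s < l e" "s < 0" by (auto simp: s_def)
  have r: "r > 0" using s by (simp add: r_def divide_neg_pos)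
  define v where "v = s + r * (u e - s)"
  have l0: "s + r * (l e - s) = 0" using s by (simp add: r_def)
  have "r * (l e - s) < r * (u e - s)" using r lu by simp
  then have v: "v > 0" using l0 by (simp add: v_def)
  have "reach (\<lambda>A. C * unif (hbox l u) A) (\<lambda>A. C * unif (hbox (l(e := 0)) (u(e := v))) A)"
    using reach_stretch[of e r s l C u, OF e r] s by (simp add: l0 v_def)
  also have "reach \<dots> (\<lambda>A. C * unif (hbox (l(e := 0)) (u(e := 1))) A)"
    using reach_stretch[of e "1 / v" 0 "l(e := 0)" C "u(e := v)", OF e] v by simp
  finally show ?thesis .
qed

abbreviation unit_hbox :: "'a::euclidean_space set" where
  "unit_hbox \<equiv> hbox (\<lambda>_. 0) (\<lambda>_. 1)"

lemma reach_unit_hbox: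
  fixes l u :: "'a::euclidean_space \<Rightarrow> real"
  assumes lu: "\<And>i. i \<in> Basis \<Longrightarrow> l i < u i"
  shows "reach (\<lambda>A. C * unif (hbox l u) A) (\<lambda>A. C * unif unit_hbox A)"
proof -
  have "reach (\<lambda>A. C * unif (hbox l u) A)
     (\<lambda>A. C * unif (hbox (\<lambda>i. if i \<in> S then 0 else l i) (\<lambda>i. if i \<in> S then 1 else u i)) A)"
    if "finite S" "S \<subseteq> Basis" for S
    using that
  proof (induction S rule: finite_induct)
    case empty
    show ?case by (auto intro: reach_eqI)
  next
    case (insert e S)
    let ?l = "\<lambda>i. if i \<in> S then 0 else l i" and ?u = "\<lambda>i. if i \<in> S then 1 else u i"
    have "reach (\<lambda>A. C * unif (hbox l u) A) (\<lambda>A. C * unif (hbox ?l ?u) A)" using insert by auto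
    also have "reach \<dots> (\<lambda>A. C * unif (hbox (?l(e := 0)) (?u(e := 1))) A)"
      using insert lu by (intro reach_normalize_coordinate) auto
    also have "?l(e := 0) = (\<lambda>i. if i \<in> insert e S then 0 else l i)" by auto
    also have "?u(e := 1) = (\<lambda>i. if i \<in> insert e S then 1 else u i)" by auto
    finally show ?case .
  qed
  from this[of Basis] show ?thesis by (simp add: hbox_def)
qed

text \<open>The condition on \<open>c1\<close> and \<open>c2\<close> says that the two adjacent
  slabs have the same density, called \<open>h\<close> in the proof, which is then also the density
  on their union.\<close>

lemma unif_merge:
  fixes e :: "'a::euclidean_space"
  assumes e: "e \<in> Basis" and lu: "\<And>i. i \<in> Basis - {e} \<Longrightarrow> l i < u i" and abd: "a < b" "b < d"
    and ratio: "c2 * (b - a) = c1 * (d - b)" and A: "A \<in> sets borel"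
  shows "c1 * unif (hbox (l(e := a)) (u(e := b))) A + c2 * unif (hbox (l(e := b)) (u(e := d))) A
     = (c1 + c2) * unif (hbox (l(e := a)) (u(e := d))) A"
proof -
  let ?B = "\<lambda>x y. hbox (l(e := x)) (u(e := y))"
  \<comment> \<open>The volume of the common cross-section orthogonal to \<open>e\<close>.\<close>
  define Q where "Q = (\<Prod>i\<in>Basis - {e}. u i - l i)"
  have Q: "Q > 0" unfolding Q_def using lu by (intro prod_pos) auto
  have m: "measure lborel (?B x y) = (y - x) * Q" if "x < y" for x y
  proof -
    have "measure lborel (?B x y) = (\<Prod>i\<in>Basis. (u(e := y)) i - (l(e := x)) i)"
      using lu that by (intro measure_hbox) (auto simp: less_imp_le)
    also have "\<dots> = (y - x) * (\<Prod>i\<in>Basis - {e}. (u(e := y)) i - (l(e := x)) i)"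
      using e by (subst prod.remove[of _ e]) auto
    also have "(\<Prod>i\<in>Basis - {e}. (u(e := y)) i - (l(e := x)) i) = Q"
      unfolding Q_def by (intro prod.cong) auto
    finally show ?thesis .
  qed
  have un: "?B a d = ?B a b \<union> ?B b d" and disj: "?B a b \<inter> ?B b d = {}"
    using e abd by (force simp: hbox_def)+
  have split: "measure lborel (?B a d \<inter> A) = measure lborel (?B a b \<inter> A) + measure lborel (?B b d \<inter> A)"
    unfolding un Int_Un_distrib2 using disj A
    by (intro measure_Un_AE) (auto intro!: fmeasurable_Int_fmeasurable hbox_fmeasurable)
  define h where "h = c1 / ((b - a) * Q)"
  have h: "c2 / ((d - b) * Q) = h" "(c1 + c2) / ((d - a) * Q) = h"
  proof -
    have "c2 / (d - b) = c1 / (b - a)" using ratio abd by (simp add: field_simps)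
    then show "c2 / ((d - b) * Q) = h" using Q by (simp add: h_def flip: divide_divide_eq_left)
    have "(c1 + c2) * (b - a) = c1 * (d - a)" using ratio by (simp add: algebra_simps)
    then have "(c1 + c2) / (d - a) = c1 / (b - a)" using abd by (simp add: field_simps)
    then show "(c1 + c2) / ((d - a) * Q) = h" using Q by (simp add: h_def flip: divide_divide_eq_left)
  qed
  have gen: "C * unif (?B x y) A = C / ((y - x) * Q) * measure lborel (?B x y \<inter> A)" if "x < y" for C x y
    by (simp add: unif_def m[OF that])
  have "c1 * unif (?B a b) A = h * measure lborel (?B a b \<inter> A)"
    "c2 * unif (?B b d) A = h * measure lborel (?B b d \<inter> A)"
    "(c1 + c2) * unif (?B a d) A = h * measure lborel (?B a d \<inter> A)"
    using gen[of a b c1] gen[of b d c2] gen[of a d "c1 + c2"] abd unfolding h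
    by (simp_all only: h_def order.strict_trans[OF abd])
  then show ?thesis by (simp add: split algebra_simps)
qed

text \<open>Induction on the number of slabs: after equalizing the densities of the first two they
  merge into one. All later breakpoints move in the process, so \<open>s\<close> and
  \<open>c\<close> are general. Positive masses make the stretching factor well defined and
  positive. The final upper face \<open>v\<close> is left open, as a later normalization removes
  it.\<close>

lemma reach_merge_slabs:
  fixes e :: "'a::euclidean_space" and s c :: "nat \<Rightarrow> real"
  assumes e: "e \<in> Basis" and lu: "\<And>i. i \<in> Basis - {e} \<Longrightarrow> l i < u i"
    and "strict_mono s" "\<And>m. c m > 0"
  shows "\<exists>v>s 0. reach (\<lambda>A. \<Sum>m\<le>n. c m * unif (hbox (l(e := s m)) (u(e := s (Suc m)))) A)
    (\<lambda>A. (\<Sum>m\<le>n. c m) * unif (hbox (l(e := s 0)) (u(e := v))) A)"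
  using assms(3,4)
proof (induction n arbitrary: s c)
  case 0
  then show ?case by (intro exI[of _ "s 1"]) (auto intro: reach_eqI simp: strict_mono_def)
next
  case (Suc n)
  have s: "s a < s b \<longleftrightarrow> a < b" "s a \<le> s b \<longleftrightarrow> a \<le> b" for a b
    using Suc.prems(1) by (auto simp: strict_mono_less strict_mono_less_eq)
  \<comment> \<open>Stretching beyond \<open>s 1\<close> by \<open>r\<close> gives the first two slabs the same density.\<close>
  define r where "r = c 1 * (s 1 - s 0) / (c 0 * (s 2 - s 1))"
  have r: "r > 0" unfolding r_def using Suc.prems(2) s by simp
  \<comment> \<open>The breakpoints after the stretching; those at and below its fixed hyperplane
    \<open>s 1\<close> do not move.\<close>
  define s' where "s' m = (if m = 0 then s 0 else s 1 + r * (s m - s 1))" for m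
  have s'_mono: "s' m < s' (Suc m)" for m
    using r s[of m "Suc m"] s[of 0 1] by (auto simp: s'_def)
  have s'01: "s' 0 = s 0" "s' 1 = s 1" by (auto simp: s'_def)
  define F where "F = relu_step (r - 1) e e (- s 1)"
  let ?B = "\<lambda>x y. hbox (l(e := x)) (u(e := y))"
  have F: "unif (?B (s m) (s (Suc m))) (F -` A) = unif (?B (s' m) (s' (Suc m))) A"
    if "A \<in> sets borel" for m A
  proof (cases "m = 0")
    case True
    then show ?thesis unfolding F_def using e that s'01 by (simp add: unif_stretch_before)
  next
    case False
    then have "s 1 \<le> s m" using s by simp
    then show ?thesis unfolding F_def using e that r False
      by (subst unif_stretch_beyond) (auto simp: s'_def)
  qed
  \<comment> \<open>The breakpoint \<open>s' 1\<close> disappears and the masses of the first two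
    slabs are added.\<close>
  define s'' where "s'' m = (if m = 0 then s 0 else s' (Suc m))" for m
  define c'' where "c'' m = (if m = 0 then c 0 + c 1 else c (Suc m))" for m
  have s'': "strict_mono s''"
    unfolding strict_mono_Suc_iff
  proof
    fix m
    show "s'' m < s'' (Suc m)"
      using s'_mono[of "Suc m"] s'_mono[of 0] s'01 by (cases m) (auto simp: s''_def)
  qed
  have c'': "c'' m > 0" for m using Suc.prems(2) by (simp add: c''_def add_pos_pos)
  have sumc: "(\<Sum>m\<le>n. c'' m) = (\<Sum>m\<le>Suc n. c m)"
    unfolding sum.atMost_shift[of _ "Suc n"] sum.atMost_shift[of _ n] sum.lessThan_Suc_shift
    by (simp add: c''_def)
  have merge: "(\<Sum>m\<le>Suc n. c m * unif (?B (s' m) (s' (Suc m))) A)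
      = (\<Sum>m\<le>n. c'' m * unif (?B (s'' m) (s'' (Suc m))) A)" if A: "A \<in> sets borel" for A
  proof -
    have s2: "s 2 - s 1 > 0" "c 0 > 0" using s[of 1 2] Suc.prems(2) by auto
    have "c 0 * unif (?B (s' 0) (s' 1)) A + c 1 * unif (?B (s' 1) (s' 2)) A
       = (c 0 + c 1) * unif (?B (s' 0) (s' 2)) A"
    proof (rule unif_merge[OF e lu _ _ _ A])
      show "c 1 * (s' 1 - s' 0) = c 0 * (s' 2 - s' 1)"
        using s2 by (simp add: s'01) (simp add: s'_def r_def)
    qed (use s'_mono[of 0] s'_mono[of 1] in \<open>auto simp: numeral_2_eq_2\<close>)
    then show ?thesis
      unfolding sum.atMost_shift[of _ "Suc n"] sum.atMost_shift[of _ n] sum.lessThan_Suc_shift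
      by (simp add: c''_def s''_def s'01 numeral_2_eq_2)
  qed
  obtain v where v: "v > s'' 0" and r3: "reach (\<lambda>A. \<Sum>m\<le>n. c'' m * unif (?B (s'' m) (s'' (Suc m))) A)
    (\<lambda>A. (\<Sum>m\<le>n. c'' m) * unif (?B (s'' 0) v) A)"
    using Suc.IH[of s'' c'', OF s'' c''] by (elim exE conjE) (rule that)
  have r1: "reach (\<lambda>A. \<Sum>m\<le>Suc n. c m * unif (?B (s m) (s (Suc m))) A)
      (\<lambda>A. \<Sum>m\<le>Suc n. c m * unif (?B (s m) (s (Suc m))) (F -` A))"
    unfolding F_def using e r by (intro reach_relu_map relu_map_step) auto
  have r2: "reach (\<lambda>A. \<Sum>m\<le>Suc n. c m * unif (?B (s m) (s (Suc m))) (F -` A))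
     (\<lambda>A. \<Sum>m\<le>n. c'' m * unif (?B (s'' m) (s'' (Suc m))) A)"
    by (rule reach_eqI) (simp only: F merge)
  have s''0: "s'' 0 = s 0" by (simp add: s''_def)
  show ?case
    using v reach_trans[OF r1 reach_trans[OF r2 r3]] unfolding sumc s''0
    by (intro exI[of _ v] conjI)
qed

lemma unif_bounds:
  assumes "A \<in> sets borel"
  shows "0 \<le> unif (hbox l u) A" "unif (hbox l u) A \<le> 1"
proof -
  have "measure lborel (hbox l u \<inter> A) \<le> measure lborel (hbox l u)"
    using assms by (intro measure_mono_fmeasurable hbox_fmeasurable) auto
  then show "unif (hbox l u) A \<le> 1" unfolding unif_def
    by (cases "measure lborel (hbox l u) = 0")
      (auto simp: divide_le_eq_1 zero_less_measure_iff)
qed (simp add: unif_def)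

lemma reach_slabs_unit_hbox:
  fixes e :: "'a::euclidean_space" and s c :: "nat \<Rightarrow> real"
  assumes e: "e \<in> Basis" and lu: "\<And>i. i \<in> Basis - {e} \<Longrightarrow> l i < u i"
    and s: "strict_mono s" and c: "\<And>m. c m \<ge> 0"
  shows "reach (\<lambda>A. \<Sum>m\<le>n. c m * unif (hbox (l(e := s m)) (u(e := s (Suc m)))) A)
    (\<lambda>A. (\<Sum>m\<le>n. c m) * unif unit_hbox A)"
proof (rule reach_closed)
  fix \<epsilon> :: real assume \<epsilon>: "\<epsilon> > 0"
  \<comment> \<open>Merging needs positive masses, so every slab receives a little extra mass.\<close>
  define \<eta> where "\<eta> = \<epsilon> / real (Suc n)"
  have \<eta>: "\<eta> > 0" "real (Suc n) * \<eta> = \<epsilon>" using \<epsilon> by (auto simp: \<eta>_def)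
  let ?B = "\<lambda>m. hbox (l(e := s m)) (u(e := s (Suc m)))"
  obtain v where v: "v > s 0" "reach (\<lambda>A. \<Sum>m\<le>n. (c m + \<eta>) * unif (?B m) A)
     (\<lambda>A. (\<Sum>m\<le>n. c m + \<eta>) * unif (hbox (l(e := s 0)) (u(e := v))) A)"
    using reach_merge_slabs[of e l u s "\<lambda>m. c m + \<eta>" n] e lu s c \<eta> by (auto simp: add_nonneg_pos)
  have "reach (\<lambda>A. \<Sum>m\<le>n. (c m + \<eta>) * unif (?B m) A) (\<lambda>A. (\<Sum>m\<le>n. c m + \<eta>) * unif unit_hbox A)"
    using lu v by (intro reach_trans[OF v(2) reach_unit_hbox]) auto
  moreover have "\<bar>(\<Sum>m\<le>n. c m * unif (?B m) A) - (\<Sum>m\<le>n. (c m + \<eta>) * unif (?B m) A)\<bar> \<le> \<epsilon>"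
    if A: "A \<in> sets borel" for A
  proof -
    have "\<bar>(\<Sum>m\<le>n. c m * unif (?B m) A) - (\<Sum>m\<le>n. (c m + \<eta>) * unif (?B m) A)\<bar>
        = (\<Sum>m\<le>n. \<eta> * unif (?B m) A)"
      using \<eta> unif_bounds[OF A] by (simp add: algebra_simps sum.distrib sum_nonneg)
    also have "\<dots> \<le> (\<Sum>m\<le>n. \<eta> * 1)" using \<eta> unif_bounds[OF A] by (intro sum_mono mult_left_mono) auto
    also have "\<dots> = \<epsilon>" using \<eta>(2) by simp
    finally show ?thesis .
  qed
  moreover have "\<bar>(\<Sum>m\<le>n. c m) * unif unit_hbox A - (\<Sum>m\<le>n. c m + \<eta>) * unif unit_hbox A\<bar> \<le> \<epsilon>"
    if A: "A \<in> sets borel" for A :: "'a set"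
  proof -
    have "(\<Sum>m\<le>n. c m + \<eta>) = (\<Sum>m\<le>n. c m) + \<epsilon>"
      using \<eta>(2) by (simp add: sum.distrib)
    then have "\<bar>(\<Sum>m\<le>n. c m) * unif unit_hbox A - (\<Sum>m\<le>n. c m + \<eta>) * unif unit_hbox A\<bar>
        = \<epsilon> * unif unit_hbox A"
      using \<epsilon> unif_bounds(1)[OF A] by (simp add: distrib_right abs_mult)
    also have "\<dots> \<le> \<epsilon> * 1" using \<epsilon> unif_bounds[OF A] by (intro mult_left_mono) auto
    finally show ?thesis by simp
  qed
  ultimately show "\<exists>n' m'. reach n' m' \<and>
      (\<forall>A\<in>sets borel. \<bar>(\<Sum>m\<le>n. c m * unif (?B m) A) - n' A\<bar> \<le> \<epsilon>) \<and>
      (\<forall>A\<in>sets borel. \<bar>(\<Sum>m\<le>n. c m) * unif unit_hbox A - m' A\<bar> \<le> \<epsilon>)" by blast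
qed

text \<open>Once in a row, the cells may come in any order and with gaps. Renumbering by position
  turns them into consecutive slabs, those in the gaps having mass 0.\<close>

lemma reach_cells_unit_hbox:
  fixes p :: "'k \<Rightarrow> 'a::euclidean_space \<Rightarrow> int"
  assumes \<delta>: "\<delta> > 0" and K: "finite K" "\<And>k. k \<in> K \<Longrightarrow> c k \<ge> 0"
    and inj: "\<And>k k'. \<lbrakk>k \<in> K; k' \<in> K; k \<noteq> k'\<rbrakk> \<Longrightarrow> \<exists>i\<in>Basis. p k i \<noteq> p k' i"
  shows "reach (\<lambda>A. \<Sum>k\<in>K. c k * unif (cell \<delta> (p k)) A) (\<lambda>A. (\<Sum>k\<in>K. c k) * unif unit_hbox A)"
proof -
  obtain e :: 'a where e: "e \<in> Basis" using nonempty_Basis by blast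
  obtain N where N: "inj_on N K" "reach (\<lambda>A. \<Sum>k\<in>K. c k * unif (cell \<delta> (p k)) A)
           (\<lambda>A. \<Sum>k\<in>K. c k * unif (cell \<delta> (\<lambda>i. if i = e then N k else 0)) A)"
    using reach_line_up_cells[of e \<delta> K c p, OF e \<delta> K] inj by (force simp only:)
  \<comment> \<open>A bound on all positions: shifting by \<open>b\<close> makes them natural
    numbers between 0 and \<open>2 * b\<close>.\<close>
  define b where "b = (\<Sum>k\<in>K. \<bar>N k\<bar>)"
  have b: "\<bar>N k\<bar> \<le> b" if "k \<in> K" for k
    unfolding b_def using K that by (intro member_le_sum) auto
  define h where "h k = nat (N k + b)" for k
  have h: "int (h k) = N k + b" if "k \<in> K" for k using b[OF that] by (simp add: h_def)
  have hinj: "inj_on h K"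
    using N(1) h unfolding inj_on_def by (metis add_right_cancel)
  define n where "n = nat (2 * b)"
  have hn: "h ` K \<subseteq> {..n}" using b by (force simp: h_def n_def)
  define c' where "c' m = (if m \<in> h ` K then c (inv_into K h m) else 0)" for m
  have c': "c' m \<ge> 0" for m using K inv_into_into[of m h K] by (auto simp: c'_def)
  have re: "(\<Sum>k\<in>K. c k * f (h k)) = (\<Sum>m\<le>n. c' m * f m)" for f :: "nat \<Rightarrow> real"
  proof -
    have "(\<Sum>k\<in>K. c k * f (h k)) = (\<Sum>k\<in>K. c' (h k) * f (h k))"
      using hinj by (intro sum.cong) (auto simp: c'_def)
    also have "\<dots> = (\<Sum>m\<in>h ` K. c' m * f m)" by (simp add: sum.reindex[OF hinj])
    also have "\<dots> = (\<Sum>m\<le>n. c' m * f m)"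
      using hn by (intro sum.mono_neutral_left) (auto simp: c'_def)
    finally show ?thesis .
  qed
  \<comment> \<open>The breakpoints undo the shift by \<open>b\<close>, so that slab
    \<open>h k\<close> is the cell at position \<open>N k\<close>.\<close>
  define s where "s m = \<delta> * (real m - of_int b)" for m
  have s: "strict_mono s" unfolding strict_mono_Suc_iff s_def using \<delta> by simp
  let ?B = "\<lambda>m. hbox ((\<lambda>_. 0)(e := s m)) ((\<lambda>_. \<delta>)(e := s (Suc m)))"
  have cell: "cell \<delta> (\<lambda>i. if i = e then N k else 0) = ?B (h k)" if "k \<in> K" for k
  proof -
    have "real (h k) = of_int (N k) + of_int b" using h[OF that] by (metis of_int_add of_int_of_nat_eq)
    then have "\<delta> * of_int (N k) = s (h k)" "\<delta> * of_int (N k) + \<delta> = s (Suc (h k))"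
      by (auto simp: s_def algebra_simps)
    then show ?thesis by (auto simp: cell_def hbox_def split: if_splits)
  qed
  note N(2)
  also have "(\<lambda>A. \<Sum>k\<in>K. c k * unif (cell \<delta> (\<lambda>i. if i = e then N k else 0)) A) =
      (\<lambda>A. \<Sum>m\<le>n. c' m * unif (?B m) A)"
  proof
    fix A
    have "(\<Sum>k\<in>K. c k * unif (cell \<delta> (\<lambda>i. if i = e then N k else 0)) A) = (\<Sum>k\<in>K. c k * unif (?B (h k)) A)"
      by (intro sum.cong refl) (simp add: cell)
    also have "\<dots> = (\<Sum>m\<le>n. c' m * unif (?B m) A)" by (rule re)
    finally show "(\<Sum>k\<in>K. c k * unif (cell \<delta> (\<lambda>i. if i = e then N k else 0)) A) = (\<Sum>m\<le>n. c' m * unif (?B m) A)" .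
  qed
  also have "reach \<dots> (\<lambda>A. (\<Sum>m\<le>n. c' m) * unif unit_hbox A)"
    using \<delta> by (intro reach_slabs_unit_hbox e s c') auto
  also have "(\<Sum>m\<le>n. c' m) = (\<Sum>k\<in>K. c k)" using re[of "\<lambda>_. 1"] by simp
  finally show ?thesis .
qed

section \<open>Approximation by grid densities\<close>

text \<open>With cells of side \<open>1 / 2 ^ n\<close> these indices fill the cube of half-side
  \<open>2 ^ n\<close>, so one parameter both refines the grid and exhausts the space.
  Extensionality makes the set finite and lets distinct indices differ on
  \<open>Basis\<close>.\<close>

definition grid_index :: "nat \<Rightarrow> ('a::euclidean_space \<Rightarrow> int) set" where
  "grid_index n = Basis \<rightarrow>\<^sub>E {- (2 ^ n * 2 ^ n)..<2 ^ n * 2 ^ n}"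

definition gridfun :: "nat \<Rightarrow> (('a::euclidean_space \<Rightarrow> int) \<Rightarrow> real) \<Rightarrow> 'a \<Rightarrow> real" where
  "gridfun n c x = (\<Sum>p\<in>grid_index n. c p * indicator (cell (1 / 2 ^ n) p) x)"

definition grid_point :: "nat \<Rightarrow> 'a::euclidean_space \<Rightarrow> 'a \<Rightarrow> int" where
  "grid_point n x = restrict (\<lambda>i. \<lfloor>x \<bullet> i / (1 / 2 ^ n)\<rfloor>) Basis"

lemma finite_grid_index: "finite (grid_index n)"
  unfolding grid_index_def by (intro finite_PiE) auto

lemma mem_cell_grid_point: "x \<in> cell (1 / 2 ^ n) (grid_point n x)"
proof -
  have "1 / 2 ^ n * \<lfloor>x \<bullet> i / (1 / 2 ^ n)\<rfloor> \<le> x \<bullet> i"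
     "x \<bullet> i < 1 / 2 ^ n * \<lfloor>x \<bullet> i / (1 / 2 ^ n)\<rfloor> + 1 / 2 ^ n" for i
    using floor_correct[of "x \<bullet> i / (1 / 2 ^ n)"] by (auto simp: field_simps)
  then show ?thesis by (auto simp: cell_def hbox_def grid_point_def)
qed

lemma mem_cell_iff_grid_point:
  assumes "p \<in> grid_index n"
  shows "x \<in> cell (1 / 2 ^ n) p \<longleftrightarrow> p = grid_point n x"
proof
  assume "x \<in> cell (1 / 2 ^ n) p"
  then have "\<lfloor>x \<bullet> i / (1 / 2 ^ n)\<rfloor> = p i" if "i \<in> Basis" for i
    using floor_cell[of x "1 / 2 ^ n" p i] that by simp
  then show "p = grid_point n x"
    using assms unfolding grid_point_def grid_index_def by (auto simp: PiE_def extensional_def fun_eq_iff)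
qed (simp add: mem_cell_grid_point)

text \<open>At most one cell contributes at any point, so pointwise operations on grid functions
  become operations on coefficients.\<close>

lemma gridfun_eq:
  "gridfun n c x = (if grid_point n x \<in> grid_index n then c (grid_point n x) else 0)"
proof -
  have "gridfun n c x = (\<Sum>p\<in>grid_index n. if p = grid_point n x then c p else 0)"
    unfolding gridfun_def by (intro sum.cong refl) (auto simp: mem_cell_iff_grid_point indicator_def)
  then show ?thesis by (simp add: finite_grid_index)
qed

lemma cell_fmeasurable: "cell \<delta> p \<in> fmeasurable lborel"
  by (simp add: cell_def hbox_fmeasurable)

lemma integrable_cell_Int:
  assumes "A \<in> sets borel"
  shows "integrable lborel (\<lambda>x. indicator (cell \<delta> p \<inter> A) x :: real)"
proof -
  have "cell \<delta> p \<inter> A \<in> fmeasurable lborel"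
    using assms by (intro fmeasurable_Int_fmeasurable cell_fmeasurable) auto
  then show ?thesis by (auto simp: fmeasurable_def)
qed

lemma gridfun_integrable: "integrable lborel (gridfun n c)"
  unfolding gridfun_def[abs_def] using integrable_cell_Int[of UNIV]
  by (intro Bochner_Integration.integrable_sum integrable_mult_right) auto

text \<open>Approximation is demanded for all large \<open>n\<close>, not just for one, so that two
  functions can be approximated on a common grid and added.\<close>

definition grid_approximable :: "('a::euclidean_space \<Rightarrow> real) \<Rightarrow> bool" where
  "grid_approximable f \<longleftrightarrow>
     (\<forall>\<epsilon>>0. \<exists>n0. \<forall>n\<ge>n0. \<exists>c. (\<integral>x. \<bar>f x - gridfun n c x\<bar> \<partial>lborel) \<le> \<epsilon>)"

lemma dist_cell:
  fixes x y :: "'a::euclidean_space" and \<delta> :: real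
  assumes "x \<in> cell \<delta> p" "y \<in> cell \<delta> p"
  shows "dist x y \<le> DIM('a) * \<delta>"
proof -
  have "\<bar>(x - y) \<bullet> i\<bar> \<le> \<delta>" if "i \<in> Basis" for i
    using assms that by (force simp: cell_def hbox_def inner_diff_left)
  then have "(\<Sum>i\<in>Basis. \<bar>(x - y) \<bullet> i\<bar>) \<le> (\<Sum>i\<in>(Basis :: 'a set). \<delta>)"
    by (intro sum_mono) auto
  then show ?thesis using norm_le_l1[of "x - y"] by (simp add: dist_norm)
qed

lemma tendsto_half_power: "(\<lambda>n. C * (1 / 2 ^ n)) \<longlonglongrightarrow> (0::real)"
  using tendsto_mult_right_zero[OF LIMSEQ_power_zero[of "1 / 2 :: real"], of C]
  by (simp add: power_divide)

lemma grid_point_in_grid_index: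
  assumes "norm x < 2 ^ n"
  shows "grid_point n x \<in> grid_index n"
  unfolding grid_point_def grid_index_def
proof (intro restrict_PiE_iff[THEN iffD2] ballI)
  fix i :: 'a assume i: "i \<in> Basis"
  then have "\<bar>x \<bullet> i\<bar> < 2 ^ n" using Basis_le_norm[OF i, of x] assms by simp
  then have "\<bar>x \<bullet> i * 2 ^ n\<bar> < 2 ^ n * 2 ^ n" by (simp add: abs_mult)
  then have "of_int (- (2 ^ n * 2 ^ n)) \<le> x \<bullet> i * 2 ^ n" "x \<bullet> i * 2 ^ n < of_int (2 ^ n * 2 ^ n)"
    unfolding abs_less_iff by simp_all
  then show "\<lfloor>x \<bullet> i / (1 / 2 ^ n)\<rfloor> \<in> {- (2 ^ n * 2 ^ n)..<2 ^ n * 2 ^ n}"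
    unfolding atLeastLessThan_iff le_floor_iff floor_less_iff by simp
qed

text \<open>The cells contained in \<open>U\<close> approximate it from inside. Each point of
  \<open>U\<close> is eventually covered, since cells shrink and the grid window grows; dominated
  convergence with the indicator of \<open>U\<close> as bound gives the limit in L1.\<close>

lemma grid_approximable_open:
  fixes U :: "'a::euclidean_space set"
  assumes U: "open U" "emeasure lborel U < \<infinity>"
  shows "grid_approximable (indicator U)"
proof -
  define c where "c n p = (if cell (1 / 2 ^ n) p \<subseteq> U then 1 else 0 :: real)" for n and p :: "'a \<Rightarrow> int"
  have int: "integrable lborel (indicator U :: 'a \<Rightarrow> real)" using U by (auto simp: borel_open)
  have bd: "\<bar>indicator U x - gridfun n (c n) x\<bar> \<le> indicator U x" for n x
    using mem_cell_grid_point[of x n] by (auto simp: gridfun_eq c_def indicator_def)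
  have lim: "(\<lambda>n. \<bar>indicator U x - gridfun n (c n) x\<bar>) \<longlonglongrightarrow> 0" for x
  proof (cases "x \<in> U")
    case False
    then show ?thesis using bd[of x] by (auto intro!: tendsto_eventually)
  next
    case True
    obtain r where r: "r > 0" "ball x r \<subseteq> U" using U True open_contains_ball by blast
    have "\<forall>\<^sub>F n in sequentially. DIM('a) * (1 / 2 ^ n) < r"
      using order_tendstoD(2)[OF tendsto_half_power r(1)] by simp
    moreover have "\<forall>\<^sub>F n in sequentially. norm x * (1 / 2 ^ n) < 1"
      using order_tendstoD(2)[OF tendsto_half_power, of 1] by simp
    ultimately have "\<forall>\<^sub>F n in sequentially. \<bar>indicator U x - gridfun n (c n) x\<bar> = 0"
    proof eventually_elim
      case (elim n)
      have "grid_point n x \<in> grid_index n"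
        using elim(2) by (intro grid_point_in_grid_index) (simp add: field_simps)
      moreover have "cell (1 / 2 ^ n) (grid_point n x) \<subseteq> U"
        using dist_cell[OF mem_cell_grid_point[of x n]] elim(1) r(2) by (force simp: subset_iff)
      ultimately show ?case using True by (simp add: gridfun_eq c_def)
    qed
    then show ?thesis by (rule tendsto_eventually)
  qed
  have "(\<lambda>n. \<integral>x. \<bar>indicator U x - gridfun n (c n) x\<bar> \<partial>lborel) \<longlonglongrightarrow> integral\<^sup>L (lborel :: 'a measure) (\<lambda>_. 0)"
  proof (rule integral_dominated_convergence[where w = "indicator U"])
    show "(\<lambda>x. \<bar>indicator U x - gridfun n (c n) x\<bar>) \<in> borel_measurable lborel" for n
      using int gridfun_integrable[of n "c n"] by (intro borel_measurable_integrable) auto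
  qed (use lim bd int in auto)
  then have L: "(\<lambda>n. \<integral>x. \<bar>indicator U x - gridfun n (c n) x\<bar> \<partial>lborel) \<longlonglongrightarrow> 0" by simp
  show ?thesis
    unfolding grid_approximable_def
  proof (intro allI impI)
    fix \<epsilon> :: real assume "\<epsilon> > 0"
    from order_tendstoD(2)[OF L this] obtain n0 where
      "\<And>n. n \<ge> n0 \<Longrightarrow> (\<integral>x. \<bar>indicator U x - gridfun n (c n) x\<bar> \<partial>lborel) < \<epsilon>"
      by (auto simp: eventually_sequentially)
    then show "\<exists>n0. \<forall>n\<ge>n0. \<exists>c. (\<integral>x. \<bar>indicator U x - gridfun n c x\<bar> \<partial>lborel) \<le> \<epsilon>"
      by (intro exI[of _ n0] allI impI) (meson less_imp_le)
  qed
qed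

lemma gridfun_add: "gridfun n (\<lambda>p. c p + c' p) x = gridfun n c x + gridfun n c' x"
  by (simp add: gridfun_eq)

lemma gridfun_mult: "gridfun n (\<lambda>p. C * c p) x = C * gridfun n c x"
  by (simp add: gridfun_eq)

lemma L1_triangle:
  fixes f g h :: "'a \<Rightarrow> real"
  assumes "integrable M f" "integrable M g" "integrable M h"
  shows "(\<integral>x. \<bar>f x - h x\<bar> \<partial>M) \<le> (\<integral>x. \<bar>f x - g x\<bar> \<partial>M) + (\<integral>x. \<bar>g x - h x\<bar> \<partial>M)"
proof -
  have "(\<integral>x. \<bar>f x - h x\<bar> \<partial>M) \<le> (\<integral>x. \<bar>f x - g x\<bar> + \<bar>g x - h x\<bar> \<partial>M)"
    using assms by (intro integral_mono) auto
  also have "\<dots> = (\<integral>x. \<bar>f x - g x\<bar> \<partial>M) + (\<integral>x. \<bar>g x - h x\<bar> \<partial>M)"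
    using assms by (intro Bochner_Integration.integral_add) auto
  finally show ?thesis .
qed

lemma grid_approximable_limit:
  assumes f: "integrable lborel f"
    and ex: "\<And>\<epsilon>. \<epsilon> > 0 \<Longrightarrow> \<exists>g. integrable lborel g \<and> grid_approximable g \<and> (\<integral>x. \<bar>f x - g x\<bar> \<partial>lborel) \<le> \<epsilon>"
  shows "grid_approximable f"
  unfolding grid_approximable_def
proof (intro allI impI)
  fix \<epsilon> :: real assume \<epsilon>: "\<epsilon> > 0"
  obtain g where g: "integrable lborel g" "grid_approximable g" "(\<integral>x. \<bar>f x - g x\<bar> \<partial>lborel) \<le> \<epsilon> / 2"
    using ex[of "\<epsilon> / 2"] \<epsilon> by auto
  obtain n0 where n0: "\<And>n. n \<ge> n0 \<Longrightarrow> \<exists>c. (\<integral>x. \<bar>g x - gridfun n c x\<bar> \<partial>lborel) \<le> \<epsilon> / 2"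
    using g(2) \<epsilon> unfolding grid_approximable_def by (meson half_gt_zero)
  have "\<exists>c. (\<integral>x. \<bar>f x - gridfun n c x\<bar> \<partial>lborel) \<le> \<epsilon>" if "n \<ge> n0" for n
  proof -
    obtain c where c: "(\<integral>x. \<bar>g x - gridfun n c x\<bar> \<partial>lborel) \<le> \<epsilon> / 2" using n0[OF \<open>n \<ge> n0\<close>] by blast
    have "(\<integral>x. \<bar>f x - gridfun n c x\<bar> \<partial>lborel) \<le> \<epsilon>"
      using L1_triangle[OF f g(1) gridfun_integrable, of n c] c g(3) by linarith
    then show ?thesis by blast
  qed
  then show "\<exists>n0. \<forall>n\<ge>n0. \<exists>c. (\<integral>x. \<bar>f x - gridfun n c x\<bar> \<partial>lborel) \<le> \<epsilon>" by blast
qed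

lemma grid_approximable_mult:
  assumes f: "integrable lborel f" "grid_approximable f"
  shows "grid_approximable (\<lambda>x. C * f x)"
  unfolding grid_approximable_def
proof (intro allI impI)
  fix \<epsilon> :: real assume \<epsilon>: "\<epsilon> > 0"
  \<comment> \<open>Adding 1 avoids a separate treatment of \<open>C = 0\<close>.\<close>
  have "\<epsilon> / (\<bar>C\<bar> + 1) > 0" using \<epsilon> by simp
  then obtain n0 where n0: "\<And>n. n \<ge> n0 \<Longrightarrow> \<exists>c. (\<integral>x. \<bar>f x - gridfun n c x\<bar> \<partial>lborel) \<le> \<epsilon> / (\<bar>C\<bar> + 1)"
    using f(2) unfolding grid_approximable_def by meson
  have "\<exists>c. (\<integral>x. \<bar>C * f x - gridfun n c x\<bar> \<partial>lborel) \<le> \<epsilon>" if "n \<ge> n0" for n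
  proof -
    obtain c where c: "(\<integral>x. \<bar>f x - gridfun n c x\<bar> \<partial>lborel) \<le> \<epsilon> / (\<bar>C\<bar> + 1)" using n0[OF \<open>n \<ge> n0\<close>] by blast
    have "(\<integral>x. \<bar>C * f x - gridfun n (\<lambda>p. C * c p) x\<bar> \<partial>lborel) = (\<integral>x. \<bar>C\<bar> * \<bar>f x - gridfun n c x\<bar> \<partial>lborel)"
      by (simp add: gridfun_mult flip: abs_mult right_diff_distrib)
    also have "\<dots> = \<bar>C\<bar> * (\<integral>x. \<bar>f x - gridfun n c x\<bar> \<partial>lborel)" by simp
    also have "\<dots> \<le> (\<bar>C\<bar> + 1) * (\<epsilon> / (\<bar>C\<bar> + 1))" using c by (intro mult_mono) auto
    finally show ?thesis by (intro exI[of _ "\<lambda>p. C * c p"]) simp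
  qed
  then show "\<exists>n0. \<forall>n\<ge>n0. \<exists>c. (\<integral>x. \<bar>C * f x - gridfun n c x\<bar> \<partial>lborel) \<le> \<epsilon>" by blast
qed

lemma grid_approximable_add:
  assumes f: "integrable lborel f" "grid_approximable f" and g: "integrable lborel g" "grid_approximable g"
  shows "grid_approximable (\<lambda>x. f x + g x)"
  unfolding grid_approximable_def
proof (intro allI impI)
  fix \<epsilon> :: real assume \<epsilon>: "\<epsilon> > 0"
  obtain n0 where n0: "\<And>n. n \<ge> n0 \<Longrightarrow> \<exists>c. (\<integral>x. \<bar>f x - gridfun n c x\<bar> \<partial>lborel) \<le> \<epsilon> / 2"
    using f(2) \<epsilon> unfolding grid_approximable_def by (meson half_gt_zero)
  obtain n1 where n1: "\<And>n. n \<ge> n1 \<Longrightarrow> \<exists>c. (\<integral>x. \<bar>g x - gridfun n c x\<bar> \<partial>lborel) \<le> \<epsilon> / 2"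
    using g(2) \<epsilon> unfolding grid_approximable_def by (meson half_gt_zero)
  have "\<exists>c. (\<integral>x. \<bar>f x + g x - gridfun n c x\<bar> \<partial>lborel) \<le> \<epsilon>" if n: "n \<ge> max n0 n1" for n
  proof -
    obtain c where c: "(\<integral>x. \<bar>f x - gridfun n c x\<bar> \<partial>lborel) \<le> \<epsilon> / 2" using n0[of n] n by auto
    obtain c' where c': "(\<integral>x. \<bar>g x - gridfun n c' x\<bar> \<partial>lborel) \<le> \<epsilon> / 2" using n1[of n] n by auto
    have "(\<integral>x. \<bar>f x + g x - gridfun n (\<lambda>p. c p + c' p) x\<bar> \<partial>lborel)
       \<le> (\<integral>x. \<bar>f x - gridfun n c x\<bar> + \<bar>g x - gridfun n c' x\<bar> \<partial>lborel)"
      using f g gridfun_integrable unfolding gridfun_add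
      by (intro integral_mono integrable_abs Bochner_Integration.integrable_diff
          Bochner_Integration.integrable_add) auto
    also have "\<dots> = (\<integral>x. \<bar>f x - gridfun n c x\<bar> \<partial>lborel) + (\<integral>x. \<bar>g x - gridfun n c' x\<bar> \<partial>lborel)"
      using f g gridfun_integrable
      by (intro Bochner_Integration.integral_add integrable_abs Bochner_Integration.integrable_diff)
    finally show ?thesis using c c' by (intro exI[of _ "\<lambda>p. c p + c' p"]) linarith
  qed
  then show "\<exists>n0. \<forall>n\<ge>n0. \<exists>c. (\<integral>x. \<bar>f x + g x - gridfun n c x\<bar> \<partial>lborel) \<le> \<epsilon>" by blast
qed

text \<open>Outer regularity reduces the claim to an open superset of almost the same measure, which
  then has finite measure as well.\<close>

lemma grid_approximable_indicator:
  fixes A :: "'a::euclidean_space set"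
  assumes A: "A \<in> sets lborel" "emeasure lborel A < \<infinity>"
  shows "grid_approximable (indicator A)"
proof (rule grid_approximable_limit)
  show intA: "integrable lborel (indicator A :: 'a \<Rightarrow> real)" using A by auto
  fix \<epsilon> :: real assume \<epsilon>: "\<epsilon> > 0"
  have "A \<in> sets lebesgue" using A by auto
  then obtain U where U: "open U" "A \<subseteq> U" "U - A \<in> lmeasurable" "emeasure lebesgue (U - A) < ennreal \<epsilon>"
    by (rule sets_lebesgue_outer_open[OF _ \<epsilon>])
  have UA: "U - A \<in> sets lborel" using U A by (auto simp: borel_open)
  then have em: "emeasure lborel (U - A) < ennreal \<epsilon>" using U by simp
  have "emeasure lborel U = emeasure lborel A + emeasure lborel (U - A)"
    using plus_emeasure[OF A(1) UA] U(2) by (simp add: Un_absorb1)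
  also have "\<dots> < \<infinity>" using A em by (auto simp: ennreal_add_eq_top less_top[symmetric] intro: order.strict_trans)
  finally have finU: "emeasure lborel U < \<infinity>" .
  have intU: "integrable lborel (indicator U :: 'a \<Rightarrow> real)" using U finU by (auto simp: borel_open)
  have "(\<integral>x. \<bar>indicator A x - indicator U x :: real\<bar> \<partial>lborel) = (\<integral>x. indicator (U - A) x \<partial>lborel)"
    using U by (intro Bochner_Integration.integral_cong refl) (auto simp: indicator_def)
  also have "\<dots> = measure lborel (U - A)" using UA by simp
  also have "\<dots> \<le> \<epsilon>"
    using em \<epsilon> unfolding measure_def by (intro enn2real_leI) (auto intro: less_imp_le)
  finally show "\<exists>g. integrable lborel g \<and> grid_approximable g \<and>
      (\<integral>x. \<bar>indicator A x - g x\<bar> \<partial>lborel) \<le> \<epsilon>"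
    using intU grid_approximable_open[OF U(1) finU] by blast
qed

lemma integrable_imp_grid_approximable:
  fixes f :: "'a::euclidean_space \<Rightarrow> real"
  assumes "integrable lborel f"
  shows "grid_approximable f"
  using assms
proof (induction rule: integrable_induct)
  case (base A c)
  then have "grid_approximable (\<lambda>x. c * indicator A x)"
    by (intro grid_approximable_mult grid_approximable_indicator) auto
  then show ?case by (simp add: mult.commute)
next
  case (add f g)
  then show ?case by (intro grid_approximable_add)
next
  case (lim f s)
  have "(\<lambda>i. \<integral>x. \<bar>f x - s i x\<bar> \<partial>lborel) \<longlonglongrightarrow> integral\<^sup>L (lborel :: 'a measure) (\<lambda>_. 0)"
  \<comment> \<open>The induction rule provides approximants bounded by twice \<open>f\<close> in
    absolute value, hence the factor 3 for the difference.\<close>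
  proof (rule integral_dominated_convergence[where w = "\<lambda>x. 3 * \<bar>f x\<bar>"])
    show "AE x in lborel. (\<lambda>i. \<bar>f x - s i x\<bar>) \<longlonglongrightarrow> 0"
    proof (rule AE_I2)
      fix x
      have "(\<lambda>i. s i x) \<longlonglongrightarrow> f x" by (rule lim) simp
      then have "(\<lambda>i. \<bar>f x - s i x\<bar>) \<longlonglongrightarrow> \<bar>f x - f x\<bar>" by (intro tendsto_intros)
      then show "(\<lambda>i. \<bar>f x - s i x\<bar>) \<longlonglongrightarrow> 0" by simp
    qed
    show "AE x in lborel. norm \<bar>f x - s i x\<bar> \<le> 3 * \<bar>f x\<bar>" for i
    proof (rule AE_I2)
      fix x
      have "norm (s i x) \<le> 2 * norm (f x)" by (rule lim) simp
      then show "norm \<bar>f x - s i x\<bar> \<le> 3 * \<bar>f x\<bar>" by simp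
    qed
  qed (use lim in auto)
  then have L: "(\<lambda>i. \<integral>x. \<bar>f x - s i x\<bar> \<partial>lborel) \<longlonglongrightarrow> 0" by simp
  show ?case
  proof (rule grid_approximable_limit)
    fix \<epsilon> :: real assume "\<epsilon> > 0"
    from order_tendstoD(2)[OF L this] obtain i where "(\<integral>x. \<bar>f x - s i x\<bar> \<partial>lborel) < \<epsilon>"
      by (auto simp: eventually_sequentially)
    then show "\<exists>g. integrable lborel g \<and> grid_approximable g \<and> (\<integral>x. \<bar>f x - g x\<bar> \<partial>lborel) \<le> \<epsilon>"
      using lim by (intro exI[of _ "s i"]) auto
  qed fact
qed

section \<open>From probability densities to the final estimate\<close>

lemma measure_cell_pos: "\<delta> > 0 \<Longrightarrow> measure lborel (cell \<delta> p) > 0"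
  unfolding cell_def by (subst measure_hbox) (auto simp: power_Suc)

lemma integral_gridfun:
  fixes A :: "'a::euclidean_space set"
  assumes A: "A \<in> sets borel"
  shows "(\<integral>x. gridfun n c x * indicator A x \<partial>lborel)
     = (\<Sum>p\<in>grid_index n. (c p * measure lborel (cell (1 / 2 ^ n) p)) * unif (cell (1 / 2 ^ n) p) A)"
proof -
  have "(\<integral>x. gridfun n c x * indicator A x \<partial>lborel)
      = (\<integral>x. (\<Sum>p\<in>grid_index n. c p * indicator (cell (1 / 2 ^ n) p \<inter> A) x) \<partial>lborel)"
    by (simp add: gridfun_def sum_distrib_right indicator_inter_arith mult.assoc)
  also have "\<dots> = (\<Sum>p\<in>grid_index n. \<integral>x. c p * indicator (cell (1 / 2 ^ n) p \<inter> A) x \<partial>lborel)"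
    using integrable_cell_Int[OF A] by (intro Bochner_Integration.integral_sum integrable_mult_right)
  also have "\<dots> = (\<Sum>p\<in>grid_index n. (c p * measure lborel (cell (1 / 2 ^ n) p)) * unif (cell (1 / 2 ^ n) p) A)"
  proof (intro sum.cong refl)
    fix p :: "'a \<Rightarrow> int"
    show "(\<integral>x. c p * indicator (cell (1 / 2 ^ n) p \<inter> A) x \<partial>lborel)
        = (c p * measure lborel (cell (1 / 2 ^ n) p)) * unif (cell (1 / 2 ^ n) p) A"
      using measure_cell_pos[of "1 / 2 ^ n" p] by (simp add: unif_def)
  qed
  finally show ?thesis .
qed

text \<open>A grid density close to \<open>f\<close> in L1 reaches a multiple of the uniform
  density. Its total mass is within \<open>\<epsilon>\<close> of 1, so the targets are close too,
  and closedness of \<open>reach\<close> absorbs both errors.\<close>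

lemma reach_prob_density_unit_hbox:
  fixes f :: "'a::euclidean_space \<Rightarrow> real"
  assumes "prob_density f"
  shows "reach (measure (density lborel (\<lambda>x. ennreal (f x)))) (unif unit_hbox)"
proof (rule reach_closed)
  fix \<epsilon> :: real assume \<epsilon>: "\<epsilon> > 0"
  have f: "integrable lborel f" "AE x in lborel. 0 \<le> f x" "(\<integral>x. f x \<partial>lborel) = 1"
    using assms by (auto simp: prob_density_def)
  obtain n c where nc: "(\<integral>x. \<bar>f x - gridfun n c x\<bar> \<partial>lborel) \<le> \<epsilon>"
    using integrable_imp_grid_approximable[OF f(1)] \<epsilon> unfolding grid_approximable_def by blast
  \<comment> \<open>Absolute values make the coefficients nonnegative and, as \<open>f\<close> is
    nonnegative almost everywhere, do not increase the distance to \<open>f\<close>.\<close>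
  define g where "g = gridfun n (\<lambda>p. \<bar>c p\<bar>)"
  have g: "integrable lborel g" unfolding g_def by (rule gridfun_integrable)
  have g_abs: "g x = \<bar>gridfun n c x\<bar>" for x by (simp add: g_def gridfun_eq)
  have "(\<integral>x. \<bar>f x - g x\<bar> \<partial>lborel) \<le> (\<integral>x. \<bar>f x - gridfun n c x\<bar> \<partial>lborel)"
  proof (rule integral_mono_AE)
    show "AE x in lborel. \<bar>f x - g x\<bar> \<le> \<bar>f x - gridfun n c x\<bar>"
      using f(2) by eventually_elim (auto simp: g_abs)
    show "integrable lborel (\<lambda>x. \<bar>f x - g x\<bar>)" using f(1) g by auto
    show "integrable lborel (\<lambda>x. \<bar>f x - gridfun n c x\<bar>)" using f(1) gridfun_integrable[of n c] by auto
  qed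
  with nc have fg: "(\<integral>x. \<bar>f x - g x\<bar> \<partial>lborel) \<le> \<epsilon>" by linarith
  define w where "w p = \<bar>c p\<bar> * measure lborel (cell (1 / 2 ^ n) p)" for p :: "'a \<Rightarrow> int"
  let ?m = "\<lambda>A. \<Sum>p\<in>grid_index n. w p * unif (cell (1 / 2 ^ n) p) A"
  have m: "?m A = (\<integral>x. g x * indicator A x \<partial>lborel)" if "A \<in> sets borel" for A
    unfolding g_def w_def by (rule integral_gridfun[OF that, symmetric])
  have r: "reach ?m (\<lambda>A. (\<Sum>p\<in>grid_index n. w p) * unif unit_hbox A)"
  proof (rule reach_cells_unit_hbox)
    show "\<exists>i\<in>Basis. p i \<noteq> p' i" if "p \<in> grid_index n" "p' \<in> grid_index n" "p \<noteq> p'" for p p' :: "'a \<Rightarrow> int"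
      using that PiE_ext[of p Basis _ p'] unfolding grid_index_def by blast
  qed (auto simp: finite_grid_index w_def)
  have close: "\<bar>(\<integral>x. f x * indicator A x \<partial>lborel) - (\<integral>x. g x * indicator A x \<partial>lborel)\<bar> \<le> \<epsilon>"
    if A: "A \<in> sets borel" for A
  proof -
    have iA: "integrable lborel (\<lambda>x. f x * indicator A x)" "integrable lborel (\<lambda>x. g x * indicator A x)"
      using f(1) g A by (auto intro!: integrable_real_mult_indicator)
    have "\<bar>(\<integral>x. f x * indicator A x \<partial>lborel) - (\<integral>x. g x * indicator A x \<partial>lborel)\<bar>
        = \<bar>\<integral>x. f x * indicator A x - g x * indicator A x \<partial>lborel\<bar>"
      using iA by simp
    also have "\<dots> \<le> (\<integral>x. \<bar>f x * indicator A x - g x * indicator A x\<bar> \<partial>lborel)"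
      by (rule integral_abs_bound)
    also have "\<dots> \<le> (\<integral>x. \<bar>f x - g x\<bar> \<partial>lborel)"
      using f(1) g iA by (intro integral_mono) (auto simp: indicator_def)
    finally show ?thesis using fg by linarith
  qed
  have "\<bar>measure (density lborel (\<lambda>x. ennreal (f x))) A - ?m A\<bar> \<le> \<epsilon>" if "A \<in> sets borel" for A
    using close[OF that] measure_density_lborel[OF f(1,2) that] m[OF that] by simp
  moreover have "\<bar>unif unit_hbox A - (\<Sum>p\<in>grid_index n. w p) * unif unit_hbox A\<bar> \<le> \<epsilon>"
    if A: "A \<in> sets borel" for A :: "'a set"
  proof -
    \<comment> \<open>Evaluating the mixture on the whole space identifies the sum of the weights
      with the integral of \<open>g\<close>.\<close>
    have "unif (cell (1 / 2 ^ n) p) UNIV = 1" for p :: "'a \<Rightarrow> int"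
      using measure_cell_pos[of "1 / 2 ^ n" p] by (simp add: unif_def)
    then have "(\<Sum>p\<in>grid_index n. w p) = (\<integral>x. g x \<partial>lborel)"
      using m[of UNIV] by simp
    then have "\<bar>1 - (\<Sum>p\<in>grid_index n. w p)\<bar> \<le> \<epsilon>" using close[of UNIV] f(3) by simp
    moreover have "unif unit_hbox A - (\<Sum>p\<in>grid_index n. w p) * unif unit_hbox A
        = (1 - (\<Sum>p\<in>grid_index n. w p)) * unif unit_hbox A" by (simp add: algebra_simps)
    ultimately show ?thesis
      using unif_bounds[OF A, of "\<lambda>_. 0" "\<lambda>_. 1"] mult_mono[of "\<bar>1 - (\<Sum>p\<in>grid_index n. w p)\<bar>" \<epsilon> "unif unit_hbox A" 1] \<epsilon>
      by (simp add: abs_mult)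
  qed
  ultimately show "\<exists>n' m'. reach n' m' \<and>
      (\<forall>A\<in>sets borel. \<bar>measure (density lborel (\<lambda>x. ennreal (f x))) A - n' A\<bar> \<le> \<epsilon>) \<and>
      (\<forall>A\<in>sets borel. \<bar>unif unit_hbox A - m' A\<bar> \<le> \<epsilon>)"
    using r by (intro exI conjI ballI)
qed

text \<open>Preimages of null sets are null, so the pushforward has a Radon-Nikodym density. Its
  total mass is finite; hence the density is finite almost everywhere and has an integrable real
  representative.\<close>

lemma relu_map_transported_density:
  fixes f :: "'a::euclidean_space \<Rightarrow> real"
  assumes "prob_density f" "relu_map (Phi T)"
  shows "\<exists>f1. transported_density T Phi f f1"
proof -
  let ?M = "density lborel (\<lambda>x. ennreal (f x))"
  let ?N = "distr ?M lborel (Phi T)"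
  have f: "integrable lborel f" "AE x in lborel. 0 \<le> f x"
    using assms by (auto simp: prob_density_def)
  have [measurable]: "Phi T \<in> borel_measurable borel" "f \<in> borel_measurable borel"
    using relu_map_measurable[OF assms(2)] f(1) by auto
  have "absolutely_continuous lborel ?N"
    unfolding absolutely_continuous_def
  proof
    fix X :: "'a set" assume X: "X \<in> null_sets lborel"
    then have "Phi T -` X \<in> null_sets lborel" by (rule relu_map_vimage_null[OF assms(2)])
    then have "Phi T -` X \<in> null_sets ?M"
      by (subst null_sets_density_iff) (auto intro: AE_not_in simp: null_setsD2 elim: AE_mp[OF AE_not_in])
    then show "X \<in> null_sets ?N"
      using X by (subst null_sets_distr_iff) (auto simp: null_sets_def)
  qed
  then obtain h where h[measurable]: "h \<in> borel_measurable lborel" and hN: "density lborel h = ?N"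
    using sigma_finite_measure.Radon_Nikodym[OF sigma_finite_lborel, of ?N] by auto
  interpret N: finite_measure ?N
    using finite_measure_density_lborel[OF f] by (rule finite_measure.finite_measure_distr) simp
  have "(\<integral>\<^sup>+x. h x \<partial>lborel) = emeasure ?N (space ?N)"
    unfolding hN[symmetric] by (subst emeasure_density) auto
  then have fin: "(\<integral>\<^sup>+x. h x \<partial>lborel) \<noteq> \<infinity>" using N.emeasure_finite by simp
  then have AEfin: "AE x in lborel. ennreal (enn2real (h x)) = h x"
    using nn_integral_PInf_AE[of h lborel] by (auto elim!: AE_mp simp: less_top)
  have "integrable lborel (\<lambda>x. enn2real (h x))"
  proof (rule integrableI_nonneg)
    show "(\<integral>\<^sup>+x. ennreal (enn2real (h x)) \<partial>lborel) < \<infinity>"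
      using fin nn_integral_cong_AE[OF AEfin] by (simp add: less_top)
  qed auto
  moreover have "density lborel (\<lambda>x. ennreal (enn2real (h x))) = ?N"
    unfolding hN[symmetric] using AEfin by (intro density_cong) auto
  ultimately show ?thesis
    unfolding transported_density_def by (intro exI[of _ "\<lambda>x. enn2real (h x)"]) auto
qed

text \<open>The sign of \<open>f - g\<close> splits the space into \<open>P\<close> and its
  complement. The L1 distance is the sum of the differences of mass on these two sets, whence the
  factor 2.\<close>

lemma L1_le_setwise:
  fixes f g :: "'a::euclidean_space \<Rightarrow> real"
  assumes f: "integrable lborel f" and g: "integrable lborel g"
    and close: "\<And>A. A \<in> sets borel \<Longrightarrow>
      \<bar>(\<integral>x. f x * indicator A x \<partial>lborel) - (\<integral>x. g x * indicator A x \<partial>lborel)\<bar> \<le> \<epsilon>"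
  shows "(\<integral>x. \<bar>f x - g x\<bar> \<partial>lborel) \<le> 2 * \<epsilon>"
proof -
  have [measurable]: "f \<in> borel_measurable borel" "g \<in> borel_measurable borel" using f g by auto
  define P where "P = {x \<in> space borel. g x < f x}"
  have P[measurable]: "P \<in> sets borel" unfolding P_def by measurable
  have i: "integrable lborel (\<lambda>x. h x * indicator A x :: real)"
    if "integrable lborel h" "A \<in> sets borel" for h :: "'a \<Rightarrow> real" and A
    using that by (auto intro!: integrable_real_mult_indicator)
  note ii = i[OF f P] i[OF g P] i[OF f borel_comp[OF P]] i[OF g borel_comp[OF P]]
  have "(\<integral>x. \<bar>f x - g x\<bar> \<partial>lborel) =
     (\<integral>x. (f x * indicator P x - g x * indicator P x) + (g x * indicator (- P) x - f x * indicator (- P) x) \<partial>lborel)"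
    by (intro Bochner_Integration.integral_cong) (auto simp: P_def indicator_def)
  also have "\<dots> = ((\<integral>x. f x * indicator P x \<partial>lborel) - (\<integral>x. g x * indicator P x \<partial>lborel))
     + ((\<integral>x. g x * indicator (- P) x \<partial>lborel) - (\<integral>x. f x * indicator (- P) x \<partial>lborel))"
    using ii by simp
  also have "\<dots> \<le> 2 * \<epsilon>" using close[OF P] close[OF borel_comp[OF P]] by linarith
  finally show ?thesis .
qed

theorem theorem1:
  fixes rho0 rhoT :: "'a::euclidean_space \<Rightarrow> real" and T \<epsilon> :: real
  assumes "prob_density rho0" and "prob_density rhoT" and "T > 0" and "\<epsilon> > 0"
  shows "\<exists>(w::real \<Rightarrow> 'a) (a::real \<Rightarrow> 'a) (b::real \<Rightarrow> real) Phi rho1.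
           piecewise_constant T w \<and> piecewise_constant T a \<and> piecewise_constant T b \<and>
           is_flow T (relu_field w a b) Phi \<and>
           transported_density T Phi rho0 rho1 \<and>
           (\<integral>x. \<bar>rho1 x - rhoT x\<bar> \<partial>lborel) \<le> \<epsilon>"
proof -
  let ?M = "\<lambda>f. density lborel (\<lambda>x::'a. ennreal (f x))"
  \<comment> \<open>Both densities reach the uniform one on the unit cube, and the second path is
    reversed.\<close>
  have "reach (measure (?M rho0)) (measure (?M rhoT))"
    using reach_trans[OF reach_prob_density_unit_hbox[OF assms(1)]
        reach_sym[OF reach_prob_density_unit_hbox[OF assms(2)]]] .
  then obtain F where F: "relu_map F"
    \<comment> \<open>Half of \<open>\<epsilon>\<close> is allotted because passing from setwise to
      L1 distance doubles the error.\<close>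
    "\<And>A. A \<in> sets borel \<Longrightarrow> \<bar>measure (?M rho0) (F -` A) - measure (?M rhoT) A\<bar> \<le> \<epsilon> / 2"
    using assms(4) unfolding reach_def by (meson half_gt_zero)
  obtain w a b Phi where flow: "piecewise_constant T w" "piecewise_constant T a" "piecewise_constant T b"
    "is_flow T (relu_field w a b) Phi" "Phi T = F"
    using relu_map_realizable[OF F(1) assms(3)] unfolding realizable_def by blast
  obtain rho1 where rho1: "transported_density T Phi rho0 rho1"
    using relu_map_transported_density[OF assms(1), of Phi T] flow(5) F(1) by blast
  have r1: "integrable lborel rho1" "AE x in lborel. 0 \<le> rho1 x" "distr (?M rho0) lborel F = ?M rho1"
    using rho1 flow(5) by (auto simp: transported_density_def)
  have rT: "integrable lborel rhoT" "AE x in lborel. 0 \<le> rhoT x"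
    using assms(2) by (auto simp: prob_density_def)
  have "(\<integral>x. \<bar>rho1 x - rhoT x\<bar> \<partial>lborel) \<le> 2 * (\<epsilon> / 2)"
  proof (rule L1_le_setwise[OF r1(1) rT(1)])
    fix A :: "'a set" assume A: "A \<in> sets borel"
    have "measure (?M rho1) A = measure (?M rho0) (F -` A)"
      unfolding r1(3)[symmetric] using A relu_map_measurable[OF F(1)]
      by (subst measure_distr) auto
    then show "\<bar>(\<integral>x. rho1 x * indicator A x \<partial>lborel) - (\<integral>x. rhoT x * indicator A x \<partial>lborel)\<bar> \<le> \<epsilon> / 2"
      using F(2)[OF A] measure_density_lborel[OF r1(1,2) A] measure_density_lborel[OF rT A] by simp
  qed
  then have "(\<integral>x. \<bar>rho1 x - rhoT x\<bar> \<partial>lborel) \<le> \<epsilon>" by simp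
  with flow(1-4) rho1 show ?thesis by blast
qed

end
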